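(* Let $T$ and $T'$ be reduced linear trellises of the same length. If $T$ and $T'$ are isomorphic, then they are linearly isomorphic. Equivalently: if the vertex sets of a reduced trellis $T$ carry two vector space structures each of which makes $T$ linear, the two resulting linear trellises are linearly isomorphic.
   Context: Let $\mathbb{F}$ be a finite field and $n\ge1$; indices are taken in $\mathbb{Z}_n$. A trellis $T$ of length $n$ over $\mathbb{F}$ consists of pairwise disjoint finite vertex sets $V_i(T)$, $i\in\mathbb{Z}_n$, and edge sets $E_i(T)\subseteq V_i(T)\times\mathbb{F}\times V_{i+1}(T)$; $(v,\alpha,w)\in E_i(T)$ is an edge from $v$ to $w$ with label $\alpha$. Trellises are trim (each vertex has an outgoing and an incoming edge). $T$ is linear if each $V_i(T)$ is an $\mathbb{F}$-vector space and each $E_i(T)$ is a subspace of $V_i(T)\times\mathbb{F}\times V_{i+1}(T)$. A cycle is a closed path of length $n$ starting in $V_0(T)$; $T$ is reduced if every edge lies on some cycle. An isomorphism $f:T\to T'$ of trellises of the same length is a family of bijections $f_i:V_i(T)\to V_i(T')$ with $(v,\alpha,w)\in E_i(T)\iff(f_i(v),\alpha,f_{i+1}(w))\in E_i(T')$ for all $i$; it is a linear isomorphism if $T,T'$ are linear and all $f_i$ are linear. *)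

theory Defs
  imports Main
begin

text \<open>A trellis of length n over a finite field 'f is given by vertex sets V i and
edge sets E i for i < n (indices in Z_n are represented by 0..n-1, successor
of i is Suc i mod n, predecessor is (i + n - 1) mod n).\<close>

definition trellis ::
  "nat \<Rightarrow> (nat \<Rightarrow> 'v set) \<Rightarrow> (nat \<Rightarrow> ('v \<times> 'f::{field,finite} \<times> 'v) set) \<Rightarrow> bool" where
  "trellis n V E \<longleftrightarrow>
     n \<ge> 1 \<and>
     (\<forall>i<n. finite (V i)) \<and>
     (\<forall>i<n. \<forall>j<n. i \<noteq> j \<longrightarrow> V i \<inter> V j = {}) \<and>
     (\<forall>i<n. E i \<subseteq> V i \<times> UNIV \<times> V (Suc i mod n)) \<and>
     (\<forall>i<n. \<forall>v\<in>V i. (\<exists>a w. (v, a, w) \<in> E i) \<and>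
                      (\<exists>u a. (u, a, v) \<in> E ((i + n - 1) mod n)))"

definition is_cycle ::
  "nat \<Rightarrow> (nat \<Rightarrow> 'v set) \<Rightarrow> (nat \<Rightarrow> ('v \<times> 'f \<times> 'v) set) \<Rightarrow> (nat \<Rightarrow> 'v) \<Rightarrow> (nat \<Rightarrow> 'f) \<Rightarrow> bool" where
  "is_cycle n V E vs as \<longleftrightarrow>
     vs 0 \<in> V 0 \<and> (\<forall>i<n. (vs i, as i, vs (Suc i)) \<in> E i) \<and> vs n = vs 0"

definition reduced ::
  "nat \<Rightarrow> (nat \<Rightarrow> 'v set) \<Rightarrow> (nat \<Rightarrow> ('v \<times> 'f \<times> 'v) set) \<Rightarrow> bool" where
  "reduced n V E \<longleftrightarrow>
     (\<forall>i<n. \<forall>e\<in>E i. \<exists>vs as. is_cycle n V E vs as \<and> e = (vs i, as i, vs (Suc i)))"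

definition vector_space_on ::
  "'v set \<Rightarrow> ('v \<Rightarrow> 'v \<Rightarrow> 'v) \<Rightarrow> ('f::field \<Rightarrow> 'v \<Rightarrow> 'v) \<Rightarrow> 'v \<Rightarrow> bool" where
  "vector_space_on S add smul z \<longleftrightarrow>
     z \<in> S \<and>
     (\<forall>x\<in>S. \<forall>y\<in>S. add x y \<in> S) \<and>
     (\<forall>a. \<forall>x\<in>S. smul a x \<in> S) \<and>
     (\<forall>x\<in>S. \<forall>y\<in>S. \<forall>w\<in>S. add (add x y) w = add x (add y w)) \<and>
     (\<forall>x\<in>S. \<forall>y\<in>S. add x y = add y x) \<and>
     (\<forall>x\<in>S. add z x = x) \<and>
     (\<forall>x\<in>S. \<exists>y\<in>S. add x y = z) \<and>
     (\<forall>a. \<forall>x\<in>S. \<forall>y\<in>S. smul a (add x y) = add (smul a x) (smul a y)) \<and>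
     (\<forall>a b. \<forall>x\<in>S. smul (a + b) x = add (smul a x) (smul b x)) \<and>
     (\<forall>a b. \<forall>x\<in>S. smul (a * b) x = smul a (smul b x)) \<and>
     (\<forall>x\<in>S. smul 1 x = x)"

definition linear_trellis ::
  "nat \<Rightarrow> (nat \<Rightarrow> 'v set) \<Rightarrow> (nat \<Rightarrow> ('v \<times> 'f::{field,finite} \<times> 'v) set)
   \<Rightarrow> (nat \<Rightarrow> 'v \<Rightarrow> 'v \<Rightarrow> 'v) \<Rightarrow> (nat \<Rightarrow> 'f \<Rightarrow> 'v \<Rightarrow> 'v) \<Rightarrow> (nat \<Rightarrow> 'v) \<Rightarrow> bool" where
  "linear_trellis n V E add smul z \<longleftrightarrow>
     trellis n V E \<and>
     (\<forall>i<n. vector_space_on (V i) (add i) (smul i) (z i)) \<and>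
     (\<forall>i<n. (z i, 0, z (Suc i mod n)) \<in> E i \<and>
        (\<forall>v a w v' a' w'. (v, a, w) \<in> E i \<longrightarrow> (v', a', w') \<in> E i \<longrightarrow>
            (add i v v', a + a', add (Suc i mod n) w w') \<in> E i) \<and>
        (\<forall>c v a w. (v, a, w) \<in> E i \<longrightarrow>
            (smul i c v, c * a, smul (Suc i mod n) c w) \<in> E i))"

definition trellis_iso ::
  "nat \<Rightarrow> (nat \<Rightarrow> 'v set) \<Rightarrow> (nat \<Rightarrow> ('v \<times> 'f \<times> 'v) set)
   \<Rightarrow> (nat \<Rightarrow> 'w set) \<Rightarrow> (nat \<Rightarrow> ('w \<times> 'f \<times> 'w) set) \<Rightarrow> (nat \<Rightarrow> 'v \<Rightarrow> 'w) \<Rightarrow> bool" where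
  "trellis_iso n V E V' E' f \<longleftrightarrow>
     (\<forall>i<n. bij_betw (f i) (V i) (V' i)) \<and>
     (\<forall>i<n. \<forall>v\<in>V i. \<forall>w\<in>V (Suc i mod n). \<forall>a.
        (v, a, w) \<in> E i \<longleftrightarrow> (f i v, a, f (Suc i mod n) w) \<in> E' i)"

definition linear_trellis_iso ::
  "nat \<Rightarrow> (nat \<Rightarrow> 'v set) \<Rightarrow> (nat \<Rightarrow> ('v \<times> 'f::field \<times> 'v) set)
   \<Rightarrow> (nat \<Rightarrow> 'v \<Rightarrow> 'v \<Rightarrow> 'v) \<Rightarrow> (nat \<Rightarrow> 'f \<Rightarrow> 'v \<Rightarrow> 'v)
   \<Rightarrow> (nat \<Rightarrow> 'w set) \<Rightarrow> (nat \<Rightarrow> ('w \<times> 'f \<times> 'w) set)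
   \<Rightarrow> (nat \<Rightarrow> 'w \<Rightarrow> 'w \<Rightarrow> 'w) \<Rightarrow> (nat \<Rightarrow> 'f \<Rightarrow> 'w \<Rightarrow> 'w)
   \<Rightarrow> (nat \<Rightarrow> 'v \<Rightarrow> 'w) \<Rightarrow> bool" where
  "linear_trellis_iso n V E add smul V' E' add' smul' f \<longleftrightarrow>
     trellis_iso n V E V' E' f \<and>
     (\<forall>i<n. (\<forall>x\<in>V i. \<forall>y\<in>V i. f i (add i x y) = add' i (f i x) (f i y)) \<and>
            (\<forall>c. \<forall>x\<in>V i. f i (smul i c x) = smul' i c (f i x)))"

end

theory Submission
  imports Defs "HOL-Library.FuncSet"
begin

text \<open>
  The cycles of a reduced linear trellis form a vector space \<open>C\<close>; the vertex space at time \<open>i\<close> is the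
  quotient of \<open>C\<close> by the cycles through the zero vertex at time \<open>i\<close>, and the edges are projections of
  cycles. So it suffices to find a label-preserving linear bijection between the two cycle spaces
  that matches these subspaces. It is constructed one dimension at a time along the subspaces \<open>C_A\<close>
  of cycles whose vertices vanish outside an arc \<open>A\<close> of the time circle, taken by increasing length.
  The given isomorphism, translated to fix zero, maps \<open>C_A\<close> bijectively onto the corresponding
  subspace with labels preserved, so counting shows that there is always room for the extension.
  The construction is consistent because a cycle in \<open>C_A\<close> that is a sum of cycles supported on other
  arcs at most as long as \<open>A\<close> splits, by cutting and splicing paths, into cycles supported on the two
  maximal proper subarcs of \<open>A\<close>.
\<close>

section \<open>Vector spaces on carrier sets\<close>

locale vspace =
  fixes S :: "'a set" and add :: "'a \<Rightarrow> 'a \<Rightarrow> 'a" and smul :: "'f::field \<Rightarrow> 'a \<Rightarrow> 'a" and z :: 'a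
  assumes vs: "vector_space_on S add smul z"
begin

lemma zero_mem [simp]: "z \<in> S"
  and add_mem [simp]: "x \<in> S \<Longrightarrow> y \<in> S \<Longrightarrow> add x y \<in> S"
  and smul_mem [simp]: "x \<in> S \<Longrightarrow> smul c x \<in> S"
  and assoc: "x \<in> S \<Longrightarrow> y \<in> S \<Longrightarrow> w \<in> S \<Longrightarrow> add (add x y) w = add x (add y w)"
  and comm: "x \<in> S \<Longrightarrow> y \<in> S \<Longrightarrow> add x y = add y x"
  and zero_left [simp]: "x \<in> S \<Longrightarrow> add z x = x"
  and ex_neg: "x \<in> S \<Longrightarrow> \<exists>y\<in>S. add x y = z"
  and smul_add: "x \<in> S \<Longrightarrow> y \<in> S \<Longrightarrow> smul c (add x y) = add (smul c x) (smul c y)"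
  and add_smul: "x \<in> S \<Longrightarrow> smul (c + d) x = add (smul c x) (smul d x)"
  and mult_smul: "x \<in> S \<Longrightarrow> smul (c * d) x = smul c (smul d x)"
  and smul_one [simp]: "x \<in> S \<Longrightarrow> smul 1 x = x"
  by (insert vs, unfold vector_space_on_def, meson+)

lemma smul_smul: "x \<in> S \<Longrightarrow> smul c (smul d x) = smul (c * d) x"
  by (simp add: mult_smul)

lemma zero_right [simp]: "x \<in> S \<Longrightarrow> add x z = x"
  by (simp add: comm[of x z])

lemma left_comm: "x \<in> S \<Longrightarrow> y \<in> S \<Longrightarrow> w \<in> S \<Longrightarrow> add x (add y w) = add y (add x w)"
  by (metis assoc comm)

lemma cancel:
  assumes "x \<in> S" "y \<in> S" "w \<in> S" "add x y = add x w"
  shows "y = w"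
proof -
  obtain x' where x': "x' \<in> S" "add x x' = z" using ex_neg assms(1) by blast
  have "add (add x' x) y = add (add x' x) w" using assms x' by (simp add: assoc)
  thus ?thesis using assms x' by (simp add: comm[of x' x])
qed

lemma smul_0 [simp]: "x \<in> S \<Longrightarrow> smul 0 x = z"
  using add_smul[of x 0 0] cancel[of "smul 0 x" "smul 0 x" z] by simp

lemma smul_zero [simp]: "smul c z = z"
  using smul_add[of z z c] cancel[of "smul c z" "smul c z" z] by simp

lemma add_minus [simp]: "x \<in> S \<Longrightarrow> add x (smul (-1) x) = z"
  using add_smul[of x 1 "-1"] by simp

lemma diff_add [simp]: "x \<in> S \<Longrightarrow> y \<in> S \<Longrightarrow> add (add x (smul (-1) y)) y = x"
  by (simp add: assoc comm[of "smul (-1) y" y])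

lemma add_diff [simp]: "x \<in> S \<Longrightarrow> y \<in> S \<Longrightarrow> add y (add x (smul (-1) y)) = x"
  by (subst comm) simp_all

lemma add_diff_right [simp]: "x \<in> S \<Longrightarrow> y \<in> S \<Longrightarrow> add (add x y) (smul (-1) y) = x"
  by (simp add: assoc)

lemma diff_eq_zero: "x \<in> S \<Longrightarrow> y \<in> S \<Longrightarrow> add x (smul (-1) y) = z \<longleftrightarrow> x = y"
  by (metis add_minus diff_add zero_left)

lemma medial:
  "x \<in> S \<Longrightarrow> y \<in> S \<Longrightarrow> u \<in> S \<Longrightarrow> v \<in> S \<Longrightarrow> add (add x y) (add u v) = add (add x u) (add y v)"
  by (simp add: assoc left_comm[of y u v])

section \<open>Subspaces of a carrier space\<close>

definition subsp :: "'a set \<Rightarrow> bool" where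
  "subsp X \<longleftrightarrow> X \<subseteq> S \<and> z \<in> X \<and> (\<forall>x\<in>X. \<forall>y\<in>X. add x y \<in> X) \<and> (\<forall>c. \<forall>x\<in>X. smul c x \<in> X)"

lemma subspD:
  assumes "subsp X"
  shows "x \<in> X \<Longrightarrow> x \<in> S" "z \<in> X" "x \<in> X \<Longrightarrow> y \<in> X \<Longrightarrow> add x y \<in> X" "x \<in> X \<Longrightarrow> smul c x \<in> X"
  using assms unfolding subsp_def by auto

lemma subsp_S: "subsp S"
  by (simp add: subsp_def)

lemma subsp_add_cancel:
  assumes "subsp X" "x \<in> X" "u \<in> S"
  shows "add u x \<in> X \<longleftrightarrow> u \<in> X"
proof
  assume "add u x \<in> X"
  hence "add (add u x) (smul (-1) x) \<in> X" using assms subspD by blast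
  thus "u \<in> X" using assms subspD(1) by simp
qed (use assms subspD in blast)

end

text \<open>Models a cycle space: each \<open>lab i\<close> is a linear functional, giving the edge
  label of a cycle at time \<open>i\<close>. Finiteness of \<open>S\<close> is there for the
  counting in \<open>extend\<close>.\<close>

locale labelled_space = vspace S add smul z
  for S :: "'a set" and add :: "'a \<Rightarrow> 'a \<Rightarrow> 'a" and smul :: "'f::field \<Rightarrow> 'a \<Rightarrow> 'a" and z :: 'a +
  fixes lab :: "'i \<Rightarrow> 'a \<Rightarrow> 'f"
  assumes fin: "finite S"
    and lab_add: "x \<in> S \<Longrightarrow> y \<in> S \<Longrightarrow> lab i (add x y) = lab i x + lab i y"
    and lab_smul: "x \<in> S \<Longrightarrow> lab i (smul c x) = c * lab i x"
begin

lemma lab_zero [simp]: "lab i z = 0"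
  using lab_smul[of z i 0] by simp

end

section \<open>Extending label-preserving partial isomorphisms\<close>

locale labelled_pair =
  A: labelled_space S add smul z lab + B: labelled_space S' add' smul' z' lab'
  for S :: "'a set" and add and smul :: "'f::field \<Rightarrow> 'a \<Rightarrow> 'a" and z and lab :: "'i \<Rightarrow> 'a \<Rightarrow> 'f"
  and S' :: "'b set" and add' and smul' :: "'f::field \<Rightarrow> 'b \<Rightarrow> 'b" and z' and lab' :: "'i \<Rightarrow> 'b \<Rightarrow> 'f"
begin

text \<open>A linear map between subspaces, encoded by its graph so that both sides are treated
  alike and enlarging the map is inclusion. By linearity, the clause on zeros says that the graph is
  single-valued and injective.\<close>

definition partial_iso :: "('a \<times> 'b) set \<Rightarrow> bool" where
  "partial_iso G \<longleftrightarrow> G \<subseteq> S \<times> S' \<and> (z, z') \<in> G \<and>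
     (\<forall>x x' y y'. (x, x') \<in> G \<longrightarrow> (y, y') \<in> G \<longrightarrow> (add x y, add' x' y') \<in> G) \<and>
     (\<forall>c x x'. (x, x') \<in> G \<longrightarrow> (smul c x, smul' c x') \<in> G) \<and>
     (\<forall>x x'. (x, x') \<in> G \<longrightarrow> (x = z \<longleftrightarrow> x' = z')) \<and>
     (\<forall>x x' i. (x, x') \<in> G \<longrightarrow> lab i x = lab' i x')"

lemma partial_isoD:
  assumes "partial_iso G"
  shows "(x, x') \<in> G \<Longrightarrow> x \<in> S" "(x, x') \<in> G \<Longrightarrow> x' \<in> S'" "(z, z') \<in> G"
    "(x, x') \<in> G \<Longrightarrow> (y, y') \<in> G \<Longrightarrow> (add x y, add' x' y') \<in> G"
    "(x, x') \<in> G \<Longrightarrow> (smul c x, smul' c x') \<in> G"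
    "(x, x') \<in> G \<Longrightarrow> x = z \<longleftrightarrow> x' = z'"
    "(x, x') \<in> G \<Longrightarrow> lab i x = lab' i x'"
proof -
  note * = assms[unfolded partial_iso_def]
  show "(x, x') \<in> G \<Longrightarrow> x \<in> S" "(x, x') \<in> G \<Longrightarrow> x' \<in> S'"
    using *[THEN conjunct1] by auto
  note * = *[THEN conjunct2]
  show "(z, z') \<in> G" by (rule *[THEN conjunct1])
  note * = *[THEN conjunct2]
  show "(x, x') \<in> G \<Longrightarrow> (y, y') \<in> G \<Longrightarrow> (add x y, add' x' y') \<in> G"
    using *[THEN conjunct1] by simp
  note * = *[THEN conjunct2]
  show "(x, x') \<in> G \<Longrightarrow> (smul c x, smul' c x') \<in> G"
    using *[THEN conjunct1] by simp
  note * = *[THEN conjunct2]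
  show "(x, x') \<in> G \<Longrightarrow> x = z \<longleftrightarrow> x' = z'"
    using *[THEN conjunct1] by simp
  show "(x, x') \<in> G \<Longrightarrow> lab i x = lab' i x'"
    using *[THEN conjunct2] by simp
qed

text \<open>The difference of the two pairs is again in \<open>G\<close>, so the clause on zeros
  applies to it.\<close>

lemma partial_iso_inj:
  assumes "partial_iso G" "(x, x') \<in> G" "(y, y') \<in> G"
  shows "x = y \<longleftrightarrow> x' = y'"
proof -
  note D = partial_isoD[OF assms(1)]
  have "(add x (smul (-1) y), add' x' (smul' (-1) y')) \<in> G" using D assms by blast
  hence "add x (smul (-1) y) = z \<longleftrightarrow> add' x' (smul' (-1) y') = z'" by (rule D)
  thus ?thesis using D(1,2)[OF assms(2)] D(1,2)[OF assms(3)] by (simp add: A.diff_eq_zero B.diff_eq_zero)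
qed

lemma Domain_subsp: "partial_iso G \<Longrightarrow> A.subsp (Domain G)"
  unfolding A.subsp_def using partial_isoD(1,3,4,5) by (meson Domain.cases DomainI subsetI)

lemma Range_subsp: "partial_iso G \<Longrightarrow> B.subsp (Range G)"
  unfolding B.subsp_def using partial_isoD(2,3,4,5) by (meson Range.cases RangeI subsetI)

section \<open>One-dimensional extension of a partial isomorphism\<close>

definition adjoin :: "('a \<times> 'b) set \<Rightarrow> 'a \<Rightarrow> 'b \<Rightarrow> ('a \<times> 'b) set" where
  "adjoin G x x' = {(add u (smul c x), add' u' (smul' c x')) | u u' c. (u, u') \<in> G}"

text \<open>The only delicate clause is the one on zeros: a relation
  \<open>add u (smul c x) = z\<close> with \<open>c\<close> nonzero would put \<open>x\<close> into
  \<open>Domain G\<close>, so \<open>c = 0\<close> and the clause for \<open>G\<close> decides. The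
  range side is symmetric.\<close>

lemma adjoin_partial_iso:
  assumes G: "partial_iso G" and x: "x \<in> S" "x \<notin> Domain G" and x': "x' \<in> S'" "x' \<notin> Range G"
    and l: "\<And>i. lab i x = lab' i x'"
  shows "partial_iso (adjoin G x x')"
proof -
  note D = partial_isoD[OF G]
  have zero_iff: "c = 0 \<and> u = z" if "u \<in> Domain G" "add u (smul c x) = z" for u c
  proof -
    have uS: "u \<in> S" using that D by blast
    have "c = 0"
    proof (rule ccontr)
      assume c: "c \<noteq> 0"
      have "smul c x = add (smul c x) z" using x by simp
      also have "\<dots> = add (add (smul c x) u) (smul (-1) u)" using x uS by (simp add: A.assoc)
      also have "\<dots> = smul (-1) u" using that x uS by (simp add: A.comm[of "smul c x" u])
      finally have "smul c x \<in> Domain G" using that A.subspD[OF Domain_subsp[OF G]] by simp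
      hence "smul (inverse c) (smul c x) \<in> Domain G" using A.subspD[OF Domain_subsp[OF G]] by blast
      thus False using x c by (simp add: A.smul_smul)
    qed
    thus ?thesis using that uS x by simp
  qed
  have zero_iff': "c = 0 \<and> u = z'" if "u \<in> Range G" "add' u (smul' c x') = z'" for u c
  proof -
    have uS: "u \<in> S'" using that D by blast
    have "c = 0"
    proof (rule ccontr)
      assume c: "c \<noteq> 0"
      have "smul' c x' = add' (smul' c x') z'" using x' by simp
      also have "\<dots> = add' (add' (smul' c x') u) (smul' (-1) u)" using x' uS by (simp add: B.assoc)
      also have "\<dots> = smul' (-1) u" using that x' uS by (simp add: B.comm[of "smul' c x'" u])
      finally have "smul' c x' \<in> Range G" using that B.subspD[OF Range_subsp[OF G]] by simp
      hence "smul' (inverse c) (smul' c x') \<in> Range G" using B.subspD[OF Range_subsp[OF G]] by blast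
      thus False using x' c by (simp add: B.smul_smul)
    qed
    thus ?thesis using that uS x' by simp
  qed
  show ?thesis
    unfolding partial_iso_def
  proof (intro conjI allI impI)
    show "adjoin G x x' \<subseteq> S \<times> S'" unfolding adjoin_def using D(1,2) x(1) x'(1) by fastforce
    have "(z, z') = (add z (smul 0 x), add' z' (smul' 0 x'))" using x x' by simp
    thus "(z, z') \<in> adjoin G x x'" unfolding adjoin_def using D(3) by blast
  next
    fix p p' q q' assume "(p, p') \<in> adjoin G x x'" "(q, q') \<in> adjoin G x x'"
    then obtain u u' c v v' d where *: "(u, u') \<in> G" "(v, v') \<in> G" "p = add u (smul c x)"
      "p' = add' u' (smul' c x')" "q = add v (smul d x)" "q' = add' v' (smul' d x')"
      unfolding adjoin_def by blast
    have "add p q = add (add u v) (smul (c + d) x)" "add' p' q' = add' (add' u' v') (smul' (c + d) x')"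
      using *(3-) D(1,2)[OF *(1)] D(1,2)[OF *(2)] x x' by (simp_all add: A.medial[of u "smul c x" v "smul d x"] A.add_smul
          B.medial[of u' "smul' c x'" v' "smul' d x'"] B.add_smul)
    thus "(add p q, add' p' q') \<in> adjoin G x x'" unfolding adjoin_def using D(4) * by blast
  next
    fix d p p' assume "(p, p') \<in> adjoin G x x'"
    then obtain u u' c where *: "(u, u') \<in> G" "p = add u (smul c x)" "p' = add' u' (smul' c x')"
      unfolding adjoin_def by blast
    have "smul d p = add (smul d u) (smul (d * c) x)" "smul' d p' = add' (smul' d u') (smul' (d * c) x')"
      using *(2-) D(1,2)[OF *(1)] x x' by (simp_all add: A.smul_add B.smul_add A.smul_smul B.smul_smul)
    thus "(smul d p, smul' d p') \<in> adjoin G x x'" unfolding adjoin_def using D(5) * by blast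
  next
    fix p p' assume "(p, p') \<in> adjoin G x x'"
    then obtain u u' c where *: "(u, u') \<in> G" "p = add u (smul c x)" "p' = add' u' (smul' c x')"
      unfolding adjoin_def by blast
    have "u' \<in> Range G" "u \<in> Domain G" using * by auto
    thus "p = z \<longleftrightarrow> p' = z'"
      using * zero_iff[of u c] zero_iff'[of u' c] D(6)[OF *(1)] x x' by auto
  next
    fix p p' i assume "(p, p') \<in> adjoin G x x'"
    then obtain u u' c where *: "(u, u') \<in> G" "p = add u (smul c x)" "p' = add' u' (smul' c x')"
      unfolding adjoin_def by blast
    thus "lab i p = lab' i p'"
      using D(1,2)[OF *(1)] D(7)[OF *(1)] l x x' by (simp add: A.lab_add A.lab_smul B.lab_add B.lab_smul)
  qed
qed

lemma adjoin_mono: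
  assumes "partial_iso G" "x \<in> S" "x' \<in> S'"
  shows "G \<subseteq> adjoin G x x'"
proof (rule subrelI)
  fix u u' assume u: "(u, u') \<in> G"
  hence "(add u (smul 0 x), add' u' (smul' 0 x')) \<in> adjoin G x x'" unfolding adjoin_def by blast
  thus "(u, u') \<in> adjoin G x x'" using partial_isoD(1,2)[OF assms(1) u] assms by simp
qed

lemma adjoin_new:
  assumes "partial_iso G" "x \<in> S" "x' \<in> S'"
  shows "(x, x') \<in> adjoin G x x'"
proof -
  have "(add z (smul 1 x), add' z' (smul' 1 x')) \<in> adjoin G x x'"
    unfolding adjoin_def using partial_isoD(3)[OF assms(1)] by blast
  thus ?thesis using assms by simp
qed

text \<open>The two clauses about \<open>Q\<close> say that nothing is added beyond the span of the
  old domain and \<open>X\<close> (of the old range and \<open>X'\<close>). They keep the domain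
  under control when several subspaces are treated in turn.\<close>

definition extends_by :: "('a \<times> 'b) set \<Rightarrow> 'a set \<Rightarrow> 'b set \<Rightarrow> ('a \<times> 'b) set \<Rightarrow> bool" where
  "extends_by G X X' G' \<longleftrightarrow> partial_iso G' \<and> G \<subseteq> G' \<and> X \<subseteq> Domain G' \<and> X' \<subseteq> Range G' \<and>
    (\<forall>a b. (a, b) \<in> G' \<longrightarrow> (a \<in> X \<longleftrightarrow> b \<in> X')) \<and>
    (\<forall>Q. A.subsp Q \<longrightarrow> Domain G \<subseteq> Q \<longrightarrow> X \<subseteq> Q \<longrightarrow> Domain G' \<subseteq> Q) \<and>
    (\<forall>Q. B.subsp Q \<longrightarrow> Range G \<subseteq> Q \<longrightarrow> X' \<subseteq> Q \<longrightarrow> Range G' \<subseteq> Q)"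

lemma extends_byD:
  assumes "extends_by G X X' G'"
  shows "partial_iso G'" "G \<subseteq> G'" "X \<subseteq> Domain G'" "X' \<subseteq> Range G'"
    "\<And>a b. (a, b) \<in> G' \<Longrightarrow> a \<in> X \<longleftrightarrow> b \<in> X'"
    "\<And>Q. A.subsp Q \<Longrightarrow> Domain G \<subseteq> Q \<Longrightarrow> X \<subseteq> Q \<Longrightarrow> Domain G' \<subseteq> Q"
    "\<And>Q. B.subsp Q \<Longrightarrow> Range G \<subseteq> Q \<Longrightarrow> X' \<subseteq> Q \<Longrightarrow> Range G' \<subseteq> Q"
  using assms unfolding extends_by_def by simp_all

text \<open>Pairs \<open>(x, x')\<close> of uncovered vectors with equal labels are adjoined until
  \<open>X\<close> is covered. The bijection \<open>h\<close> need be neither linear nor consistent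
  with \<open>G\<close>: it serves to compare cardinalities and to supply vectors with prescribed
  labels.\<close>

lemma extend:
  assumes "partial_iso G" and X: "A.subsp X" and X': "B.subsp X'"
    and h: "bij_betw h X X'" and hl: "\<And>x i. x \<in> X \<Longrightarrow> lab' i (h x) = lab i x"
    and "\<And>a b. (a, b) \<in> G \<Longrightarrow> a \<in> X \<longleftrightarrow> b \<in> X'"
  shows "\<exists>G'. extends_by G X X' G'"
  using assms(1,6)
proof (induction "card (X - Domain G)" arbitrary: G rule: less_induct)
  case less
  note G = less.prems(1) and compat = less.prems(2)
  note D = partial_isoD[OF G]
  have finX: "finite X" "finite X'"
    using X X' A.fin B.fin unfolding A.subsp_def B.subsp_def by (auto intro: finite_subset)
  \<comment> \<open>\<open>G\<close> is a bijection from its domain to its range, so it matches the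
    covered part of \<open>Y\<close> with that of \<open>Y'\<close> whenever it respects the two
    sets.\<close>
  have card_eq: "card (Y \<inter> Domain G) = card (Y' \<inter> Range G)"
    if YY: "\<And>a b. (a, b) \<in> G \<Longrightarrow> a \<in> Y \<longleftrightarrow> b \<in> Y'" for Y Y'
  proof -
    let ?R = "{(a, b) \<in> G. a \<in> Y}"
    have inj: "inj_on fst ?R" "inj_on snd ?R"
      unfolding inj_on_def using partial_iso_inj[OF G] by (clarify, simp only: fst_conv snd_conv)+
    have dom: "fst ` ?R = Y \<inter> Domain G" by force
    have "?R = {(a, b) \<in> G. b \<in> Y'}" using YY by blast
    moreover have "snd ` {(a, b) \<in> G. b \<in> Y'} = Y' \<inter> Range G" by force
    ultimately have ran: "snd ` ?R = Y' \<inter> Range G" by (simp only:)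
    show ?thesis using card_image[OF inj(1)] card_image[OF inj(2)] by (simp only: dom ran)
  qed
  show ?case
  proof (cases "X \<subseteq> Domain G")
    case True
    have "card (X' \<inter> Range G) = card X'"
      using card_eq[of X X'] compat True bij_betw_same_card[OF h] by (simp add: Int_absorb2)
    hence "X' \<inter> Range G = X'" using finX by (intro card_subset_eq) auto
    hence "X' \<subseteq> Range G" by blast
    hence "extends_by G X X' G" unfolding extends_by_def using G compat True by simp
    thus ?thesis ..
  next
    case False
    have "\<exists>x x'. x \<in> X \<and> x' \<in> X' \<and> x \<notin> Domain G \<and> x' \<notin> Range G \<and> (\<forall>i. lab i x = lab' i x')"
    proof (cases "\<exists>x. x \<in> X - Domain G \<and> (\<forall>i. lab i x = 0)")
      case True
      \<comment> \<open>Some vector of \<open>X\<close> with all labels zero is uncovered. The label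
        kernels \<open>K\<close> and \<open>K'\<close> have equal size through \<open>h\<close>, and
        their covered parts have equal size through \<open>G\<close>, so \<open>K'\<close> has an
        uncovered vector too; any such vector is a valid partner.\<close>
      define K where "K = {x \<in> X. \<forall>i. lab i x = 0}"
      define K' where "K' = {x \<in> X'. \<forall>i. lab' i x = 0}"
      have "bij_betw h K K'"
        using h hl unfolding K_def K'_def bij_betw_def inj_on_def by (auto simp: image_iff)
      hence cK: "card K = card K'" by (rule bij_betw_same_card)
      have "\<And>a b. (a, b) \<in> G \<Longrightarrow> a \<in> K \<longleftrightarrow> b \<in> K'"
        unfolding K_def K'_def using compat D(7) by force
      hence "card (K \<inter> Domain G) = card (K' \<inter> Range G)" by (rule card_eq)
      moreover have "card (K \<inter> Domain G) < card K"
        using True finX unfolding K_def by (intro psubset_card_mono) auto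
      ultimately have "K' \<inter> Range G \<noteq> K'" using cK by auto
      then obtain x' where "x' \<in> X'" "x' \<notin> Range G" "\<forall>i. lab' i x' = 0"
        unfolding K'_def by blast
      moreover obtain x where "x \<in> X" "x \<notin> Domain G" "\<forall>i. lab i x = 0" using True by blast
      ultimately show ?thesis by (intro exI[of _ x] exI[of _ x']) simp
    next
      case nok: False
      \<comment> \<open>Now \<open>Domain G\<close> contains all of the label kernel of
        \<open>X\<close>, and \<open>h x\<close> is a valid partner of \<open>x\<close>: if it were
        already the partner of some \<open>w\<close>, then \<open>x - w\<close> would have zero
        labels, hence be covered, and \<open>x\<close> with it.\<close>
      obtain x where x: "x \<in> X" "x \<notin> Domain G" using False by blast
      have hx: "h x \<in> X'" using h x by (auto simp: bij_betw_def)
      have "h x \<notin> Range G"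
      proof
        assume "h x \<in> Range G"
        then obtain w where w: "(w, h x) \<in> G" by blast
        have wX: "w \<in> X" using compat[OF w] hx by simp
        let ?d = "add x (smul (-1) w)"
        have S: "x \<in> S" "w \<in> S" using A.subspD(1)[OF X] x wX by auto
        have dX: "?d \<in> X" using A.subspD[OF X] x wX by blast
        have "lab i ?d = 0" for i
          using D(7)[OF w, of i] hl[OF x(1), of i] S by (simp add: A.lab_add A.lab_smul)
        hence "?d \<in> Domain G" using nok dX by blast
        hence "add ?d w \<in> Domain G" using A.subspD(3)[OF Domain_subsp[OF G]] w by blast
        thus False using x S by simp
      qed
      thus ?thesis using x hx hl by (intro exI[of _ x] exI[of _ "h x"]) simp
    qed
    then obtain x x' where x: "x \<in> X" "x \<notin> Domain G" and x': "x' \<in> X'" "x' \<notin> Range G"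
      and l: "\<And>i. lab i x = lab' i x'" by blast
    have xS: "x \<in> S" "x' \<in> S'" using x x' A.subspD(1)[OF X] B.subspD(1)[OF X'] by auto
    let ?H = "adjoin G x x'"
    have H: "partial_iso ?H" by (rule adjoin_partial_iso[OF G xS(1) x(2) xS(2) x'(2) l])
    have GH: "G \<subseteq> ?H" by (rule adjoin_mono[OF G xS])
    have xH: "(x, x') \<in> ?H" by (rule adjoin_new[OF G xS])
    \<comment> \<open>The added multiples lie in \<open>X\<close> and \<open>X'\<close>, so
      membership of the sums reduces to that of \<open>u\<close> and \<open>u'\<close>.\<close>
    have cH: "a \<in> X \<longleftrightarrow> b \<in> X'" if ab: "(a, b) \<in> ?H" for a b
    proof -
      obtain u u' c where *: "(u, u') \<in> G" "a = add u (smul c x)" "b = add' u' (smul' c x')"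
        using ab unfolding adjoin_def by blast
      have "smul c x \<in> X" "smul' c x' \<in> X'"
        using A.subspD(4)[OF X x(1)] B.subspD(4)[OF X' x'(1)] by auto
      thus ?thesis using * compat[OF *(1)] D(1,2)[OF *(1)]
          A.subsp_add_cancel[OF X] B.subsp_add_cancel[OF X'] by simp
    qed
    have "card (X - Domain ?H) < card (X - Domain G)"
      using x xH GH finX by (intro psubset_card_mono) auto
    from less.hyps[OF this H cH] obtain G' where "extends_by ?H X X' G'" ..
    note G' = extends_byD[OF this]
    have "Domain ?H \<subseteq> Q" if "A.subsp Q" "Domain G \<subseteq> Q" "X \<subseteq> Q" for Q
    proof
      fix a assume "a \<in> Domain ?H"
      then obtain u u' c where *: "(u, u') \<in> G" "a = add u (smul c x)" unfolding adjoin_def by blast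
      hence "u \<in> Q" "x \<in> Q" using that x by auto
      thus "a \<in> Q" unfolding *(2) by (intro A.subspD[OF that(1)])
    qed
    moreover have "Range ?H \<subseteq> Q" if "B.subsp Q" "Range G \<subseteq> Q" "X' \<subseteq> Q" for Q
    proof
      fix b assume "b \<in> Range ?H"
      then obtain u u' c where *: "(u, u') \<in> G" "b = add' u' (smul' c x')" unfolding adjoin_def by blast
      hence "u' \<in> Q" "x' \<in> Q" using that x' by auto
      thus "b \<in> Q" unfolding *(2) by (intro B.subspD[OF that(1)])
    qed
    ultimately have "extends_by G X X' G'" unfolding extends_by_def using G' GH by simp
    thus ?thesis ..
  qed
qed

text \<open>Applies \<open>extend\<close> to the \<open>X j\<close> in order. Its compatibility
  hypothesis comes from \<open>split\<close>: a covered vector of \<open>X j\<close> lies in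
  \<open>Q j\<close>, hence is a sum of vectors from earlier subspaces, and the images of these stay
  in \<open>X' j\<close> because the inclusions in \<open>split\<close> are required on the opposite
  side.\<close>

lemma extend_family:
  fixes X :: "nat \<Rightarrow> 'a set" and X' :: "nat \<Rightarrow> 'b set"
  assumes X: "\<And>j. j < N \<Longrightarrow> A.subsp (X j)" and X': "\<And>j. j < N \<Longrightarrow> B.subsp (X' j)"
    and h: "\<And>j. j < N \<Longrightarrow> bij_betw (h j) (X j) (X' j)"
    and hl: "\<And>j x i. j < N \<Longrightarrow> x \<in> X j \<Longrightarrow> lab' i (h j x) = lab i x"
    and Q: "\<And>j. j < N \<Longrightarrow> A.subsp (Q j)" and Q': "\<And>j. j < N \<Longrightarrow> B.subsp (Q' j)"
    and XQ: "\<And>i j. i < j \<Longrightarrow> j < N \<Longrightarrow> X i \<subseteq> Q j"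
    and XQ': "\<And>i j. i < j \<Longrightarrow> j < N \<Longrightarrow> X' i \<subseteq> Q' j"
    and split: "\<And>j x. j < N \<Longrightarrow> x \<in> X j \<Longrightarrow> x \<in> Q j \<Longrightarrow> x = z \<or>
       (\<exists>k<j. \<exists>l<j. \<exists>p\<in>X k. \<exists>q\<in>X l. x = add p q \<and> X' k \<subseteq> X' j \<and> X' l \<subseteq> X' j)"
    and split': "\<And>j x. j < N \<Longrightarrow> x \<in> X' j \<Longrightarrow> x \<in> Q' j \<Longrightarrow> x = z' \<or>
       (\<exists>k<j. \<exists>l<j. \<exists>p\<in>X' k. \<exists>q\<in>X' l. x = add' p q \<and> X k \<subseteq> X j \<and> X l \<subseteq> X j)"
  shows "\<exists>G. partial_iso G \<and> (\<forall>j<N. X j \<subseteq> Domain G \<and> X' j \<subseteq> Range G \<and>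
      (\<forall>a b. (a, b) \<in> G \<longrightarrow> (a \<in> X j \<longleftrightarrow> b \<in> X' j)))"
proof -
  \<comment> \<open>The clauses about \<open>P\<close> state that \<open>Domain G\<close> and
    \<open>Range G\<close> lie in the spans of the subspaces treated so far. Applied to
    \<open>Q m\<close> and \<open>Q' m\<close>, they make \<open>split\<close> and
    \<open>split'\<close> available.\<close>
  have "m \<le> N \<Longrightarrow> \<exists>G. partial_iso G \<and> (\<forall>j<m. X j \<subseteq> Domain G \<and> X' j \<subseteq> Range G \<and>
      (\<forall>a b. (a, b) \<in> G \<longrightarrow> (a \<in> X j \<longleftrightarrow> b \<in> X' j))) \<and>
      (\<forall>P. A.subsp P \<longrightarrow> (\<forall>j<m. X j \<subseteq> P) \<longrightarrow> Domain G \<subseteq> P) \<and>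
      (\<forall>P. B.subsp P \<longrightarrow> (\<forall>j<m. X' j \<subseteq> P) \<longrightarrow> Range G \<subseteq> P)" for m
  proof (induction m)
    case 0
    have "partial_iso {(z, z')}" unfolding partial_iso_def by simp
    thus ?case by (intro exI[of _ "{(z, z')}"]) (auto dest: A.subspD(2) B.subspD(2))
  next
    case (Suc m)
    then obtain G where G: "partial_iso G" and cover: "\<And>j. j < m \<Longrightarrow> X j \<subseteq> Domain G"
      "\<And>j. j < m \<Longrightarrow> X' j \<subseteq> Range G"
      and compat: "\<And>j a b. j < m \<Longrightarrow> (a, b) \<in> G \<Longrightarrow> a \<in> X j \<longleftrightarrow> b \<in> X' j"
      and dom: "\<And>P. A.subsp P \<Longrightarrow> (\<forall>j<m. X j \<subseteq> P) \<Longrightarrow> Domain G \<subseteq> P"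
      and ran: "\<And>P. B.subsp P \<Longrightarrow> (\<forall>j<m. X' j \<subseteq> P) \<Longrightarrow> Range G \<subseteq> P"
      by auto
    note D = partial_isoD[OF G]
    have m: "m < N" using Suc.prems by simp
    have domQ: "Domain G \<subseteq> Q m" using dom[OF Q[OF m]] XQ m by simp
    have ranQ: "Range G \<subseteq> Q' m" using ran[OF Q'[OF m]] XQ' m by simp
    have cm: "a \<in> X m \<longleftrightarrow> b \<in> X' m" if ab: "(a, b) \<in> G" for a b
    proof
      assume a: "a \<in> X m"
      have "a \<in> Q m" using ab domQ by blast
      from split[OF m a this] show "b \<in> X' m"
      proof (elim disjE exE conjE bexE)
        assume "a = z"
        thus ?thesis using D(6)[OF ab] B.subspD(2)[OF X'[OF m]] by simp
      next
        fix k l p q assume kl: "k < m" "l < m" and pq: "p \<in> X k" "q \<in> X l" "a = add p q"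
          and sub: "X' k \<subseteq> X' m" "X' l \<subseteq> X' m"
        obtain p' q' where pq': "(p, p') \<in> G" "(q, q') \<in> G" using cover(1) kl pq by blast
        have "p' \<in> X' m" "q' \<in> X' m" using compat kl pq pq' sub by blast+
        moreover have "b = add' p' q'" using partial_iso_inj[OF G ab D(4)[OF pq']] pq by simp
        ultimately show ?thesis using B.subspD(3)[OF X'[OF m]] by simp
      qed
    next
      assume b: "b \<in> X' m"
      have "b \<in> Q' m" using ab ranQ by blast
      from split'[OF m b this] show "a \<in> X m"
      proof (elim disjE exE conjE bexE)
        assume "b = z'"
        thus ?thesis using D(6)[OF ab] A.subspD(2)[OF X[OF m]] by simp
      next
        fix k l p' q' assume kl: "k < m" "l < m" and pq: "p' \<in> X' k" "q' \<in> X' l" "b = add' p' q'"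
          and sub: "X k \<subseteq> X m" "X l \<subseteq> X m"
        obtain p q where pq': "(p, p') \<in> G" "(q, q') \<in> G" using cover(2) kl pq by blast
        have "p \<in> X m" "q \<in> X m" using compat kl pq pq' sub by blast+
        moreover have "a = add p q" using partial_iso_inj[OF G ab D(4)[OF pq']] pq by simp
        ultimately show ?thesis using A.subspD(3)[OF X[OF m]] by simp
      qed
    qed
    from extend[OF G X[OF m] X'[OF m] h[OF m] hl[OF m] cm]
    obtain G' where "extends_by G (X m) (X' m) G'" by auto
    note G' = extends_byD[OF this]
    \<comment> \<open>Earlier subspaces are already covered by \<open>G\<close>, and
      \<open>G'\<close> is injective and single-valued, so no new pair can involve them.\<close>
    have c': "a \<in> X j \<longleftrightarrow> b \<in> X' j" if j: "j < m" and ab: "(a, b) \<in> G'" for j a b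
    proof
      assume "a \<in> X j"
      then obtain b' where b': "(a, b') \<in> G" using cover(1) j by blast
      hence "b = b'" using partial_iso_inj[OF G'(1) ab] G'(2) by blast
      thus "b \<in> X' j" using compat[OF j b'] \<open>a \<in> X j\<close> by simp
    next
      assume "b \<in> X' j"
      then obtain a' where a': "(a', b) \<in> G" using cover(2) j by blast
      hence "a = a'" using partial_iso_inj[OF G'(1) ab] G'(2) by blast
      thus "a \<in> X j" using compat[OF j a'] \<open>b \<in> X' j\<close> by simp
    qed
    have "X j \<subseteq> Domain G' \<and> X' j \<subseteq> Range G' \<and> (\<forall>a b. (a, b) \<in> G' \<longrightarrow> (a \<in> X j \<longleftrightarrow> b \<in> X' j))"
      if "j < Suc m" for j
    proof (cases "j = m")
      case True
      thus ?thesis using G' by blast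
    next
      case False
      hence j: "j < m" using that by simp
      show ?thesis using cover[OF j] c'[OF j] G'(2) by blast
    qed
    moreover have "Domain G' \<subseteq> P" if "A.subsp P" "\<forall>j<Suc m. X j \<subseteq> P" for P
      using that G'(6) dom by simp
    moreover have "Range G' \<subseteq> P" if "B.subsp P" "\<forall>j<Suc m. X' j \<subseteq> P" for P
      using that G'(7) ran by simp
    ultimately show ?case using G'(1) by (intro exI[of _ G'] conjI allI impI) simp_all
  qed
  from this[OF order_refl] show ?thesis by (rule ex_forward) (elim conjE, intro conjI)
qed

end

section \<open>Arcs of a cyclic order\<close>

definition arc :: "nat \<Rightarrow> nat \<Rightarrow> nat \<Rightarrow> nat set" where
  "arc n a k = (\<lambda>i. (a + i) mod n) ` {..<k}"

lemma arc_mono: "k \<le> l \<Longrightarrow> arc n a k \<subseteq> arc n a l"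
  unfolding arc_def by (intro image_mono) auto

lemma arc_0 [simp]: "arc n a 0 = {}"
  by (simp add: arc_def)

lemma arcI: "i < k \<Longrightarrow> (a + i) mod n \<in> arc n a k"
  unfolding arc_def by blast

lemma start_in_arc: "a < n \<Longrightarrow> 0 < k \<Longrightarrow> a \<in> arc n a k"
  using arcI[of 0 k a n] by simp

lemma arcE:
  assumes "t \<in> arc n a k" obtains i where "i < k" "t = (a + i) mod n"
  using assms unfolding arc_def by blast

lemma add_mod_inj:
  fixes a i j n :: nat
  assumes "i < n" "j < n" "(a + i) mod n = (a + j) mod n"
  shows "i = j"
proof -
  have "False" if "i < j" "j < n" "(a + i) mod n = (a + j) mod n" for i j
  proof -
    have "n dvd (a + j) - (a + i)"
      using that by (metis mod_eq_dvd_iff_nat nat_add_left_cancel_le less_imp_le)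
    hence "n dvd j - i" by simp
    thus False using that by (auto dest: dvd_imp_le)
  qed
  thus ?thesis using assms by (metis linorder_less_linear)
qed

lemma end_notin_arc: "k \<le> l \<Longrightarrow> l < n \<Longrightarrow> (a + l) mod n \<notin> arc n a k"
proof
  assume l: "k \<le> l" "l < n" and "(a + l) mod n \<in> arc n a k"
  then obtain i where i: "i < k" "(a + l) mod n = (a + i) mod n" by (metis arcE)
  hence "l = i" using l by (intro add_mod_inj[of l n i a]) auto
  thus False using i l by simp
qed

text \<open>With \<open>Suc_in_arc_start\<close> and \<open>pred_start_notin_arc\<close> this
  controls the boundary crossings of an arc, which is where a spliced path has to be
  checked.\<close>

lemma Suc_in_arc:
  assumes "t \<in> arc n a k"
  shows "Suc t mod n \<in> arc n a k \<or> Suc t mod n = (a + k) mod n"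
proof -
  obtain i where i: "i < k" "t = (a + i) mod n" using assms by (rule arcE)
  have s: "Suc t mod n = (a + Suc i) mod n" using i by (simp add: mod_Suc_eq)
  show ?thesis
  proof (cases "Suc i = k")
    case True
    thus ?thesis using s by simp
  next
    case False
    thus ?thesis using s i arcI[of "Suc i" k a n] by simp
  qed
qed

lemma Suc_in_arc_start:
  assumes "t < n" "a < n" "t \<notin> arc n a k" "Suc t mod n \<in> arc n a k"
  shows "Suc t mod n = a"
proof -
  obtain i where i: "i < k" "Suc t mod n = (a + i) mod n" using assms(4) by (rule arcE)
  show ?thesis
  proof (cases i)
    case 0
    thus ?thesis using i assms by simp
  next
    case (Suc i')
    have "(1 + t) mod n = (1 + (a + i') mod n) mod n" using i Suc by (simp add: mod_Suc_eq)
    hence "t = (a + i') mod n" using assms by (intro add_mod_inj[of t n "(a + i') mod n" 1]) auto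
    thus ?thesis using assms(3) arcI[of i' k a n] i Suc by simp
  qed
qed

lemma pred_start_notin_arc:
  assumes "k < n" "a < n" "Suc t mod n = a"
  shows "t \<notin> arc n a k"
proof
  assume "t \<in> arc n a k"
  then obtain i where i: "i < k" "t = (a + i) mod n" by (rule arcE)
  have "(a + Suc i) mod n = (a + 0) mod n" using i assms by (simp add: mod_Suc_eq)
  thus False using add_mod_inj[of "Suc i" n 0 a] i assms by auto
qed

lemma arc_Suc_start: "a < n \<Longrightarrow> arc n a (Suc k) = insert a (arc n (Suc a mod n) k)"
proof -
  assume a: "a < n"
  have "arc n a (Suc k) = insert (a mod n) ((\<lambda>i. (a + Suc i) mod n) ` {..<k})"
    unfolding arc_def lessThan_Suc_eq_insert_0 by (simp add: image_image)
  also have "(\<lambda>i. (a + Suc i) mod n) ` {..<k} = arc n (Suc a mod n) k"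
    unfolding arc_def by (intro image_cong) (simp_all add: mod_add_left_eq)
  finally show ?thesis using a by simp
qed

text \<open>Under containment, \<open>a\<close> sits at offset \<open>r\<close> in the other arc. If
  the arc from \<open>a\<close> stays within one turn counted from \<open>a'\<close>, its last point
  forces \<open>r = 0\<close> and equal lengths; otherwise it passes through the predecessor of
  \<open>a'\<close>, which an arc from \<open>a'\<close> of length below \<open>n\<close>
  misses.\<close>

lemma arc_not_subset:
  assumes "a < n" "a' < n" "k' \<le> k" "k < n" "(a', k') \<noteq> (a, k)" "0 < k"
  shows "\<exists>i<k. (a + i) mod n \<notin> arc n a' k'"
proof (rule ccontr)
  assume "\<not> ?thesis"
  hence sub: "(a + i) mod n \<in> arc n a' k'" if "i < k" for i using that by blast
  obtain r where r: "r < k'" "a = (a' + r) mod n"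
    using arcE[OF sub[OF assms(6)]] assms(1) by auto
  have eq: "(a + i) mod n = (a' + (r + i)) mod n" for i
    using r by (simp add: mod_add_left_eq add.assoc)
  show False
  proof (cases "r + (k - 1) < n")
    case True
    have "(a' + (r + (k - 1))) mod n \<in> arc n a' k'" using sub[of "k - 1"] assms(6) by (simp only: eq[symmetric])
    hence "r + (k - 1) < k'" using end_notin_arc[of k' "r + (k - 1)" n a'] True assms by linarith
    hence "r = 0" "k = k'" using assms by auto
    thus False using r assms by simp
  next
    case False
    have "n - 1 - r < k" using False r assms by linarith
    hence "(a + (n - 1 - r)) mod n \<in> arc n a' k'" by (rule sub)
    moreover have "r + (n - 1 - r) = n - 1" using r assms by linarith
    ultimately have "(a' + (n - 1)) mod n \<in> arc n a' k'" by (simp only: eq)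
    thus False using end_notin_arc[of k' "n - 1" n a'] assms by linarith
  qed
qed

text \<open>Turns vanishing of a cycle at the single time \<open>i\<close> into a support condition
  on an arc.\<close>

lemma arc_complement:
  assumes "i < n"
  shows "arc n (Suc i mod n) (n - 1) = {..<n} - {i}"
proof -
  obtain m where n: "n = Suc m" using assms by (cases n) auto
  have "arc n i n = {..<n}"
  proof (rule card_subset_eq)
    show "arc n i n \<subseteq> {..<n}" using assms unfolding arc_def by auto
    have "inj_on (\<lambda>j. (i + j) mod n) {..<n}" by (rule inj_onI) (auto intro: add_mod_inj)
    thus "card (arc n i n) = card {..<n}" unfolding arc_def by (simp add: card_image)
  qed simp
  moreover have "arc n i n = insert i (arc n (Suc i mod n) (n - 1))"
    using arc_Suc_start[OF assms, of m] n by simp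
  moreover have "i \<notin> arc n (Suc i mod n) (n - 1)"
  proof -
    have "(Suc i mod n + m) mod n = (i + n) mod n" using n by (simp only: mod_add_left_eq) simp
    also have "\<dots> = i" using assms by simp
    finally show ?thesis using end_notin_arc[of m m n "Suc i mod n"] n by simp
  qed
  ultimately show ?thesis by (metis Diff_insert_absorb)
qed

text \<open>Enumerates the arcs by increasing length.\<close>
definition narc :: "nat \<Rightarrow> nat \<Rightarrow> nat set" where
  "narc n j = arc n (j mod n) (j div n)"

section \<open>The cycle space of a linear trellis\<close>

locale lin_trellis =
  fixes n :: nat and V :: "nat \<Rightarrow> 'v set" and E :: "nat \<Rightarrow> ('v \<times> 'f::{field,finite} \<times> 'v) set"
    and add :: "nat \<Rightarrow> 'v \<Rightarrow> 'v \<Rightarrow> 'v" and smul :: "nat \<Rightarrow> 'f \<Rightarrow> 'v \<Rightarrow> 'v" and z :: "nat \<Rightarrow> 'v"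
  assumes lt: "linear_trellis n V E add smul z"
begin

lemma n_pos [simp]: "0 < n"
  using lt unfolding linear_trellis_def trellis_def by auto

lemma vspace_V: "t < n \<Longrightarrow> vspace (V t) (add t) (smul t) (z t)"
  using lt unfolding linear_trellis_def vspace_def by blast

lemma finite_V: "t < n \<Longrightarrow> finite (V t)"
  using lt unfolding linear_trellis_def trellis_def by blast

lemma edge_V:
  assumes "t < n" "(v, a, w) \<in> E t"
  shows "v \<in> V t" "w \<in> V (Suc t mod n)"
proof -
  have "E t \<subseteq> V t \<times> UNIV \<times> V (Suc t mod n)"
    using lt assms(1) unfolding linear_trellis_def trellis_def by blast
  thus "v \<in> V t" "w \<in> V (Suc t mod n)" using assms(2) by auto
qed

lemma E_zero: "t < n \<Longrightarrow> (z t, 0, z (Suc t mod n)) \<in> E t"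
  and E_add: "t < n \<Longrightarrow> (v, a, w) \<in> E t \<Longrightarrow> (v', a', w') \<in> E t \<Longrightarrow>
    (add t v v', a + a', add (Suc t mod n) w w') \<in> E t"
  and E_smul: "t < n \<Longrightarrow> (v, a, w) \<in> E t \<Longrightarrow>
    (smul t c v, c * a, smul (Suc t mod n) c w) \<in> E t"
  using lt unfolding linear_trellis_def by simp_all

section \<open>Cycles as functions on the time circle, with pointwise operations\<close>

definition edge :: "(nat \<Rightarrow> 'v \<times> 'f) \<Rightarrow> nat \<Rightarrow> bool" where
  "edge x t \<longleftrightarrow> (fst (x t), snd (x t), fst (x (Suc t mod n))) \<in> E t"

text \<open>Extensionality makes equality depend on the times below \<open>n\<close> only; closing
  up is built into the index \<open>Suc t mod n\<close> of \<open>edge\<close>.\<close>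

definition cyc :: "(nat \<Rightarrow> 'v \<times> 'f) set" where
  "cyc = {x \<in> extensional {..<n}. \<forall>t<n. edge x t}"

definition cadd :: "(nat \<Rightarrow> 'v \<times> 'f) \<Rightarrow> (nat \<Rightarrow> 'v \<times> 'f) \<Rightarrow> nat \<Rightarrow> 'v \<times> 'f" where
  "cadd x y = (\<lambda>t\<in>{..<n}. (add t (fst (x t)) (fst (y t)), snd (x t) + snd (y t)))"

definition csmul :: "'f \<Rightarrow> (nat \<Rightarrow> 'v \<times> 'f) \<Rightarrow> nat \<Rightarrow> 'v \<times> 'f" where
  "csmul c x = (\<lambda>t\<in>{..<n}. (smul t c (fst (x t)), c * snd (x t)))"

definition czero :: "nat \<Rightarrow> 'v \<times> 'f" where
  "czero = (\<lambda>t\<in>{..<n}. (z t, 0))"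

text \<open>The index is reduced modulo \<open>n\<close> because \<open>labelled_space\<close> asks
  for linearity at every natural number, and a cycle carries no meaningful value at times from
  \<open>n\<close> on.\<close>

definition clab :: "nat \<Rightarrow> (nat \<Rightarrow> 'v \<times> 'f) \<Rightarrow> 'f" where
  "clab t x = snd (x (t mod n))"

lemma fst_cadd [simp]: "t < n \<Longrightarrow> fst (cadd x y t) = add t (fst (x t)) (fst (y t))"
  and snd_cadd [simp]: "t < n \<Longrightarrow> snd (cadd x y t) = snd (x t) + snd (y t)"
  and fst_csmul [simp]: "t < n \<Longrightarrow> fst (csmul c x t) = smul t c (fst (x t))"
  and snd_csmul [simp]: "t < n \<Longrightarrow> snd (csmul c x t) = c * snd (x t)"
  and fst_czero [simp]: "t < n \<Longrightarrow> fst (czero t) = z t"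
  and snd_czero [simp]: "t < n \<Longrightarrow> snd (czero t) = 0"
  by (simp_all add: cadd_def csmul_def czero_def)

lemma ext_ops [simp]: "cadd x y \<in> extensional {..<n}" "csmul c x \<in> extensional {..<n}"
  "czero \<in> extensional {..<n}"
  by (simp_all add: cadd_def csmul_def czero_def)

lemma cycle_eqI:
  assumes "x \<in> extensional {..<n}" "y \<in> extensional {..<n}"
    and "\<And>t. t < n \<Longrightarrow> fst (x t) = fst (y t)" "\<And>t. t < n \<Longrightarrow> snd (x t) = snd (y t)"
  shows "x = y"
  by (rule extensionalityI[OF assms(1,2)]) (simp add: assms(3,4) prod_eq_iff)

text \<open>Stated for single edges, since it also serves for the paths in \<open>cuttable\<close>,
  which need not close up.\<close>

lemma edge_cadd: "t < n \<Longrightarrow> edge x t \<Longrightarrow> edge y t \<Longrightarrow> edge (cadd x y) t"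
  unfolding edge_def by (simp add: E_add)

lemma edge_csmul: "t < n \<Longrightarrow> edge x t \<Longrightarrow> edge (csmul c x) t"
  unfolding edge_def by (simp add: E_smul)

lemma edge_zero: "t < n \<Longrightarrow> edge czero t"
  unfolding edge_def by (simp add: E_zero)

lemma cycD: "x \<in> cyc \<Longrightarrow> x \<in> extensional {..<n}" "x \<in> cyc \<Longrightarrow> t < n \<Longrightarrow> edge x t"
  "x \<in> cyc \<Longrightarrow> t < n \<Longrightarrow> fst (x t) \<in> V t"
  unfolding cyc_def edge_def by (auto dest: edge_V)

lemma cyc_closed: "czero \<in> cyc" "x \<in> cyc \<Longrightarrow> y \<in> cyc \<Longrightarrow> cadd x y \<in> cyc" "x \<in> cyc \<Longrightarrow> csmul c x \<in> cyc"
  unfolding cyc_def by (simp_all add: edge_cadd edge_csmul edge_zero)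

lemma cyc_vspace: "vspace cyc cadd csmul czero"
  unfolding vspace_def vector_space_on_def
proof (intro conjI ballI allI)
  fix x y w assume "x \<in> cyc" "y \<in> cyc" "w \<in> cyc"
  thus "cadd (cadd x y) w = cadd x (cadd y w)"
    by (intro cycle_eqI) (simp_all add: vspace.assoc[OF vspace_V] cycD add.assoc)
next
  fix x y assume "x \<in> cyc" "y \<in> cyc"
  thus "cadd x y = cadd y x"
    by (intro cycle_eqI) (simp_all add: vspace.comm[OF vspace_V, of _ "fst (x _)"] cycD add.commute)
next
  fix x assume "x \<in> cyc"
  thus "cadd czero x = x"
    by (intro cycle_eqI) (simp_all add: vspace.zero_left[OF vspace_V] cycD)
next
  fix x assume x: "x \<in> cyc"
  have "cadd x (csmul (-1) x) = czero"
    using x by (intro cycle_eqI) (simp_all add: vspace.add_minus[OF vspace_V] cycD)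
  thus "\<exists>y\<in>cyc. cadd x y = czero" using cyc_closed(3)[OF x] by blast
next
  fix c x y assume "x \<in> cyc" "y \<in> cyc"
  thus "csmul c (cadd x y) = cadd (csmul c x) (csmul c y)"
    by (intro cycle_eqI) (simp_all add: vspace.smul_add[OF vspace_V] cycD distrib_left)
next
  fix c d x assume "x \<in> cyc"
  thus "csmul (c + d) x = cadd (csmul c x) (csmul d x)"
    by (intro cycle_eqI) (simp_all add: vspace.add_smul[OF vspace_V] cycD distrib_right)
next
  fix c d x assume "x \<in> cyc"
  thus "csmul (c * d) x = csmul c (csmul d x)"
    by (intro cycle_eqI) (simp_all add: vspace.mult_smul[OF vspace_V] cycD mult.assoc)
next
  fix x assume "x \<in> cyc"
  thus "csmul 1 x = x"
    by (intro cycle_eqI) (simp_all add: vspace.smul_one[OF vspace_V] cycD)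
qed (simp_all add: cyc_closed)

lemma finite_cyc: "finite cyc"
proof (rule finite_subset)
  show "cyc \<subseteq> PiE {..<n} (\<lambda>t. V t \<times> UNIV)"
    using cycD by (auto simp: PiE_def Pi_def mem_Times_iff)
  show "finite (PiE {..<n} (\<lambda>t. V t \<times> (UNIV :: 'f set)))"
    by (intro finite_PiE) (simp_all add: finite_V)
qed

sublocale C: labelled_space cyc cadd csmul czero clab
proof -
  interpret vspace cyc cadd csmul czero by (rule cyc_vspace)
  show "labelled_space cyc cadd csmul czero clab"
    by unfold_locales (simp_all add: clab_def finite_cyc)
qed

section \<open>Vertices and edges as projections of cycles\<close>

lemma edge_on_cycle:
  assumes "reduced n V E" "i < n" "(v, a, w) \<in> E i"
  shows "\<exists>x\<in>cyc. v = fst (x i) \<and> a = snd (x i) \<and> w = fst (x (Suc i mod n))"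
proof -
  obtain us as where c: "is_cycle n V E us as" and e: "(v, a, w) = (us i, as i, us (Suc i))"
    using assms unfolding reduced_def by blast
  define x where "x = (\<lambda>t\<in>{..<n}. (us t, as t))"
  have x: "fst (x t) = us t" "snd (x t) = as t" if "t < n" for t using that by (simp_all add: x_def)
  \<comment> \<open>The walk has a last vertex \<open>us n\<close> while \<open>x\<close> wraps
    around to time 0; the two agree because the walk is closed.\<close>
  have nx: "fst (x (Suc t mod n)) = us (Suc t)" if "t < n" for t
  proof (cases "Suc t = n")
    case True
    thus ?thesis using c x(1)[of 0] by (simp add: is_cycle_def)
  next
    case False
    thus ?thesis using that x(1)[of "Suc t"] by simp
  qed
  have "edge x t" if "t < n" for t
    unfolding edge_def nx[OF that] x[OF that] using c that by (simp add: is_cycle_def)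
  moreover have "x \<in> extensional {..<n}" by (simp add: x_def)
  ultimately have "x \<in> cyc" by (simp add: cyc_def)
  thus ?thesis using e x[OF assms(2)] nx[OF assms(2)] by (intro bexI[of _ x]) simp_all
qed

lemma vertex_on_cycle:
  assumes "reduced n V E" "i < n" "v \<in> V i"
  shows "\<exists>x\<in>cyc. v = fst (x i)"
proof -
  have "\<exists>a w. (v, a, w) \<in> E i"
    using lt assms(2,3) unfolding linear_trellis_def trellis_def by simp
  then obtain a w where "(v, a, w) \<in> E i" by blast
  from edge_on_cycle[OF assms(1,2) this] show ?thesis by blast
qed

text \<open>Labels are left free: even \<open>supp {}\<close> may contain nonzero cycles, which run
  through zero vertices along edges with nonzero labels.\<close>

definition supp :: "nat set \<Rightarrow> (nat \<Rightarrow> 'v \<times> 'f) set" where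
  "supp A = {x \<in> cyc. \<forall>t<n. t \<notin> A \<longrightarrow> fst (x t) = z t}"

lemma supp_mono: "A \<subseteq> B \<Longrightarrow> supp A \<subseteq> supp B"
  unfolding supp_def by auto

lemma supp_subsp: "C.subsp (supp A)"
  unfolding C.subsp_def supp_def
  by (auto simp: cyc_closed vspace.zero_left[OF vspace_V] vspace.smul_zero[OF vspace_V]
      vspace.zero_mem[OF vspace_V])

text \<open>The path \<open>y\<close>, of length \<open>k - 1\<close>, is what allows a cycle supported on \<open>arc n a k\<close> to be cut
  in two; the truncated \<open>k - 1\<close> makes \<open>k = 0\<close> a junk case.\<close>
definition cuttable :: "nat \<Rightarrow> nat \<Rightarrow> (nat \<Rightarrow> 'v \<times> 'f) set" where
  "cuttable a k = {x \<in> cyc. \<exists>y. fst (y a) = fst (x a) \<and>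
     fst (y ((a + (k - 1)) mod n)) = z ((a + (k - 1)) mod n) \<and> (\<forall>t\<in>arc n a (k - 1). edge y t)}"

lemma arc_lt: "t \<in> arc n a k \<Longrightarrow> t < n"
  by (auto elim!: arcE)

lemma cuttable_subsp:
  assumes "a < n"
  shows "C.subsp (cuttable a k)"
proof -
  define b where "b = (a + (k - 1)) mod n"
  have b: "b < n" by (simp add: b_def)
  interpret B: vspace "V b" "add b" "smul b" "z b" by (rule vspace_V[OF b])
  have cut: "cuttable a k = {x \<in> cyc. \<exists>y. fst (y a) = fst (x a) \<and> fst (y b) = z b \<and>
      (\<forall>t\<in>arc n a (k - 1). edge y t)}"
    by (simp only: cuttable_def b_def)
  show ?thesis
    unfolding C.subsp_def
  proof (intro conjI ballI allI)
    show "cuttable a k \<subseteq> cyc" unfolding cut by blast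
    show "czero \<in> cuttable a k" unfolding cut
      using assms b by (auto simp: cyc_closed edge_zero arc_lt intro!: exI[of _ czero])
  next
    fix x x' assume "x \<in> cuttable a k" "x' \<in> cuttable a k"
    then obtain y y' where "x \<in> cyc" "fst (y a) = fst (x a)" "fst (y b) = z b" "\<forall>t\<in>arc n a (k - 1). edge y t"
      "x' \<in> cyc" "fst (y' a) = fst (x' a)" "fst (y' b) = z b" "\<forall>t\<in>arc n a (k - 1). edge y' t"
      unfolding cut by blast
    thus "cadd x x' \<in> cuttable a k" unfolding cut
      using assms b by (auto simp: cyc_closed edge_cadd arc_lt intro!: exI[of _ "cadd y y'"])
  next
    fix c x assume "x \<in> cuttable a k"
    then obtain y where "x \<in> cyc" "fst (y a) = fst (x a)" "fst (y b) = z b" "\<forall>t\<in>arc n a (k - 1). edge y t"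
      unfolding cut by blast
    thus "csmul c x \<in> cuttable a k" unfolding cut
      using assms b by (auto simp: cyc_closed edge_csmul arc_lt intro!: exI[of _ "csmul c y"])
  qed
qed

text \<open>A cycle supported on another arc that is not longer vanishes somewhere on
  \<open>arc n a k\<close>. Following it from \<open>a\<close> up to such a time
  \<open>a + i\<close> and resting at zero from there on gives the required path.\<close>

lemma supp_subset_cuttable:
  assumes "a < n" "a' < n" "k' \<le> k" "k < n" "(a', k') \<noteq> (a, k)" "0 < k"
  shows "supp (arc n a' k') \<subseteq> cuttable a k"
proof
  fix x assume x: "x \<in> supp (arc n a' k')"
  obtain i where i: "i < k" "(a + i) mod n \<notin> arc n a' k'" using arc_not_subset[OF assms] by blast
  let ?b = "(a + (k - 1)) mod n"
  have xi: "fst (x ((a + i) mod n)) = z ((a + i) mod n)" using x i unfolding supp_def by simp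
  have xc: "x \<in> cyc" using x unfolding supp_def by simp
  define y where "y t = (if t \<in> arc n a i then x t else (z t, 0))" for t
  have "fst (y a) = fst (x a)"
  proof (cases i)
    case 0
    thus ?thesis using xi assms by (simp add: y_def)
  next
    case (Suc _)
    thus ?thesis using start_in_arc[of a n i] assms by (simp add: y_def)
  qed
  moreover have "?b \<notin> arc n a i" using i assms by (intro end_notin_arc) auto
  hence "fst (y ?b) = z ?b" by (simp add: y_def)
  moreover have "edge y t" if t: "t \<in> arc n a (k - 1)" for t
  proof (cases "t \<in> arc n a i")
    case True
    have "fst (y (Suc t mod n)) = fst (x (Suc t mod n))"
      using Suc_in_arc[OF True] xi by (auto simp: y_def)
    thus ?thesis using cycD(2)[OF xc arc_lt[OF True]] True by (simp add: edge_def y_def)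
  next
    case False
    \<comment> \<open>Having left the initial segment, the path could re-enter it only at
      \<open>a\<close>, but the predecessor of \<open>a\<close> is outside
      \<open>arc n a (k - 1)\<close>.\<close>
    have "Suc t mod n \<notin> arc n a i"
    proof
      assume "Suc t mod n \<in> arc n a i"
      hence "Suc t mod n = a" using Suc_in_arc_start[OF arc_lt[OF t] assms(1) False] by simp
      thus False using pred_start_notin_arc[of "k - 1" n a t] t assms by simp
    qed
    thus ?thesis using False E_zero[OF arc_lt[OF t]] by (simp add: edge_def y_def)
  qed
  ultimately show "x \<in> cuttable a k" unfolding cuttable_def using xc by blast
qed

text \<open>The cycle \<open>p\<close> enters \<open>a\<close> along the edge of \<open>x\<close>,
  returns to zero along the path \<open>y\<close>, and then rests at zero. Since \<open>p\<close>
  and \<open>x\<close> agree at \<open>a\<close>, the difference \<open>x - p\<close> vanishes there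
  and lives on the arc shortened at its start.\<close>

lemma supp_split:
  assumes "a < n" "Suc k < n" and x: "x \<in> supp (arc n a (Suc k))" "x \<in> cuttable a (Suc k)"
  shows "\<exists>p\<in>supp (arc n a k). \<exists>q\<in>supp (arc n (Suc a mod n) k). x = cadd p q"
proof -
  let ?b = "(a + k) mod n"
  have xc: "x \<in> cyc" and xz: "\<And>t. t < n \<Longrightarrow> t \<notin> arc n a (Suc k) \<Longrightarrow> fst (x t) = z t"
    using x(1) unfolding supp_def by auto
  obtain y where y: "fst (y a) = fst (x a)" "fst (y ?b) = z ?b" "\<And>t. t \<in> arc n a k \<Longrightarrow> edge y t"
    using x(2) unfolding cuttable_def by auto
  \<comment> \<open>The edge entering \<open>a\<close> must keep the label of \<open>x\<close>. It
    starts at the zero vertex, as \<open>Suc k < n\<close> puts the predecessor of \<open>a\<close>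
    outside the support of \<open>x\<close>.\<close>
  define p where "p = (\<lambda>t\<in>{..<n}. if t \<in> arc n a k then y t
     else (z t, if Suc t mod n = a then snd (x t) else 0))"
  have p_in: "p t = y t" if "t \<in> arc n a k" for t using that arc_lt[OF that] by (simp add: p_def)
  have p_out: "p t = (z t, if Suc t mod n = a then snd (x t) else 0)" if "t < n" "t \<notin> arc n a k" for t
    using that by (simp add: p_def)
  have pa: "fst (p a) = fst (x a)"
  proof (cases k)
    \<comment> \<open>Here the path has no edges: \<open>a\<close> is also its end, so
      \<open>x\<close> vanishes at \<open>a\<close>.\<close>
    case 0
    thus ?thesis using y(1,2) assms p_out[of a] by simp
  next
    case (Suc _)
    thus ?thesis using p_in[of a] start_in_arc[of a n k] y assms by simp
  qed
  have b: "?b \<notin> arc n a k" using assms by (intro end_notin_arc) auto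
  have "edge p t" if t: "t < n" for t
  proof (cases "t \<in> arc n a k")
    case True
    have "fst (p (Suc t mod n)) = fst (y (Suc t mod n))"
      using Suc_in_arc[OF True]
    proof
      assume "Suc t mod n \<in> arc n a k"
      thus ?thesis using p_in by simp
    next
      assume *: "Suc t mod n = ?b"
      show ?thesis unfolding * using b y(2) p_out[of ?b] by simp
    qed
    thus ?thesis using y(3)[OF True] p_in[OF True] by (simp add: edge_def)
  next
    case False
    show ?thesis
    proof (cases "Suc t mod n = a")
      case True
      have "fst (x t) = z t" using pred_start_notin_arc[OF assms(2,1) True] xz t by simp
      thus ?thesis using cycD(2)[OF xc t] p_out[OF t False] True pa by (simp add: edge_def)
    next
      case ne: False
      hence "Suc t mod n \<notin> arc n a k" using Suc_in_arc_start[OF t assms(1) False] by blast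
      thus ?thesis using E_zero[OF t] p_out[OF t False] ne p_out[of "Suc t mod n"] by (simp add: edge_def)
    qed
  qed
  moreover have "p \<in> extensional {..<n}" by (simp add: p_def)
  ultimately have pc: "p \<in> cyc" by (simp add: cyc_def)
  let ?q = "cadd x (csmul (-1) p)"
  have "p \<in> supp (arc n a k)" using pc p_out by (simp add: supp_def)
  moreover have "?q \<in> supp (arc n (Suc a mod n) k)"
    unfolding supp_def
  proof (intro CollectI conjI allI impI)
    show "?q \<in> cyc" using xc pc by simp
    fix t assume t: "t < n" "t \<notin> arc n (Suc a mod n) k"
    interpret W: vspace "V t" "add t" "smul t" "z t" by (rule vspace_V[OF t(1)])
    have "fst (x t) = fst (p t)"
    proof (cases "t = a")
      case True
      thus ?thesis using pa by simp
    next
      case False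
      hence "t \<notin> arc n a (Suc k)" using t arc_Suc_start[OF assms(1)] by simp
      moreover have "arc n a k \<subseteq> arc n a (Suc k)" by (rule arc_mono) simp
      ultimately have "t \<notin> arc n a k" by blast
      thus ?thesis using xz[OF t(1) \<open>t \<notin> arc n a (Suc k)\<close>] p_out[OF t(1)] by simp
    qed
    thus "fst (?q t) = z t" using t cycD(3)[OF pc] by simp
  qed
  moreover have "x = cadd p ?q" using xc pc by simp
  ultimately show ?thesis by blast
qed

text \<open>A subspace containing the supported cycles of all earlier arcs. Index 0 has no
  predecessors; the other indices below \<open>n\<close> repeat the empty arc, where no restriction
  is wanted because splitting is trivial.\<close>

definition narc_cut :: "nat \<Rightarrow> (nat \<Rightarrow> 'v \<times> 'f) set" where
  "narc_cut j = (if j = 0 then {czero} else if j div n = 0 then cyc else cuttable (j mod n) (j div n))"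

lemma narc_cut_subsp: "C.subsp (narc_cut j)"
  unfolding narc_cut_def using cuttable_subsp[of "j mod n" "j div n"] C.subsp_S
  by (simp add: C.subsp_def)

lemma supp_subset_narc_cut:
  assumes "i < j" "j < n * n"
  shows "supp (narc n i) \<subseteq> narc_cut j"
proof (cases "j div n = 0")
  case True
  thus ?thesis using assms by (auto simp: narc_cut_def supp_def)
next
  case False
  have "(i mod n, i div n) \<noteq> (j mod n, j div n)"
    using assms(1) by (metis div_mult_mod_eq less_irrefl prod.inject)
  moreover have "j div n < n" using assms(2) by (simp add: less_mult_imp_div_less)
  ultimately have "supp (narc n i) \<subseteq> cuttable (j mod n) (j div n)"
    unfolding narc_def using assms False by (intro supp_subset_cuttable) (simp_all add: div_le_mono)
  thus ?thesis using False assms by (simp add: narc_cut_def)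
qed

lemma narc_split:
  assumes "j < n * n" "x \<in> supp (narc n j)" "x \<in> narc_cut j"
  shows "x = czero \<or> (\<exists>k<j. \<exists>l<j. \<exists>p\<in>supp (narc n k). \<exists>q\<in>supp (narc n l). x = cadd p q \<and>
    narc n k \<subseteq> narc n j \<and> narc n l \<subseteq> narc n j)"
proof (cases "j = 0")
  case True
  thus ?thesis using assms by (simp add: narc_cut_def)
next
  case j: False
  show ?thesis
  proof (cases "j div n")
    case 0
    hence e: "narc n j = {}" "narc n 0 = {}" by (simp_all add: narc_def)
    \<comment> \<open>The empty arc already occurs at index 0, so both summands are taken from
      there.\<close>
    have "x = cadd x czero" using assms(2) by (simp add: supp_def)
    moreover have "czero \<in> supp {}" using C.subspD(2)[OF supp_subsp] .
    ultimately have "\<exists>p\<in>supp {}. \<exists>q\<in>supp {}. x = cadd p q" using assms(2) e by metis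
    thus ?thesis using j by (intro disjI2 exI[of _ 0] conjI) (simp_all add: e)
  next
    case (Suc k)
    let ?a = "j mod n"
    have a: "?a < n" "Suc ?a mod n < n" by simp_all
    have jk: "j = n * Suc k + ?a" using Suc by (metis mult_div_mod_eq)
    have "Suc k < n" using assms(1) Suc less_mult_imp_div_less by metis
    moreover have "x \<in> supp (arc n ?a (Suc k))" "x \<in> cuttable ?a (Suc k)"
      using assms(2,3) Suc j by (simp_all add: narc_def narc_cut_def)
    ultimately obtain p q where pq: "p \<in> supp (arc n ?a k)" "q \<in> supp (arc n (Suc ?a mod n) k)" "x = cadd p q"
      using supp_split[OF a(1)] by metis
    have nj: "narc n j = arc n ?a (Suc k)" using Suc by (simp add: narc_def)
    \<comment> \<open>Positions of the two subarcs in the enumeration. Both have length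
      \<open>k\<close>, so their indices are below \<open>n * Suc k\<close> and hence below
      \<open>j\<close>.\<close>
    have n1: "narc n (n * k + ?a) = arc n ?a k" using a by (simp add: narc_def)
    have n2: "narc n (n * k + Suc ?a mod n) = arc n (Suc ?a mod n) k" using a by (simp add: narc_def)
    have lt: "n * k + ?a < j" "n * k + Suc ?a mod n < j"
    proof -
      have "n * Suc k = n * k + n" by simp
      thus "n * k + ?a < j" "n * k + Suc ?a mod n < j" using jk a by linarith+
    qed
    have sub: "arc n ?a k \<subseteq> arc n ?a (Suc k)" "arc n (Suc ?a mod n) k \<subseteq> arc n ?a (Suc k)"
      by (rule arc_mono, simp) (simp add: arc_Suc_start subset_insertI)
    have "\<exists>p\<in>supp (narc n (n * k + ?a)). \<exists>q\<in>supp (narc n (n * k + Suc ?a mod n)). x = cadd p q \<and>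
        narc n (n * k + ?a) \<subseteq> narc n j \<and> narc n (n * k + Suc ?a mod n) \<subseteq> narc n j"
      unfolding n1 n2 nj using pq sub by blast
    thus ?thesis using lt by blast
  qed
qed

end

section \<open>From isomorphism to linear isomorphism\<close>

locale iso_trellis_pair =
  T: lin_trellis n V E add smul z + T': lin_trellis n V' E' add' smul' z'
  for n :: nat
    and V :: "nat \<Rightarrow> 'v set" and E :: "nat \<Rightarrow> ('v \<times> 'f::{field,finite} \<times> 'v) set"
    and add smul z
    and V' :: "nat \<Rightarrow> 'w set" and E' :: "nat \<Rightarrow> ('w \<times> 'f \<times> 'w) set"
    and add' smul' z' +
  fixes f :: "nat \<Rightarrow> 'v \<Rightarrow> 'w"
  assumes iso: "trellis_iso n V E V' E' f"
begin

sublocale P: labelled_pair T.cyc T.cadd T.csmul T.czero T.clab T'.cyc T'.cadd T'.csmul T'.czero T'.clab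
  by unfold_locales

lemma bij_f: "t < n \<Longrightarrow> bij_betw (f t) (V t) (V' t)"
  using iso unfolding trellis_iso_def by blast

lemma f_edge: "t < n \<Longrightarrow> v \<in> V t \<Longrightarrow> w \<in> V (Suc t mod n) \<Longrightarrow>
    (f t v, a, f (Suc t mod n) w) \<in> E' t \<longleftrightarrow> (v, a, w) \<in> E t"
  using iso unfolding trellis_iso_def by simp

section \<open>Transport of cycles along the given isomorphism\<close>

definition cmap :: "(nat \<Rightarrow> 'v \<times> 'f) \<Rightarrow> nat \<Rightarrow> 'w \<times> 'f" where
  "cmap x = (\<lambda>t\<in>{..<n}. (f t (fst (x t)), snd (x t)))"

lemma cmap_simps [simp]: "t < n \<Longrightarrow> fst (cmap x t) = f t (fst (x t))"
  "t < n \<Longrightarrow> snd (cmap x t) = snd (x t)" "cmap x \<in> extensional {..<n}"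
  by (simp_all add: cmap_def)

lemma f_eq_iff: "t < n \<Longrightarrow> v \<in> V t \<Longrightarrow> w \<in> V t \<Longrightarrow> f t v = f t w \<longleftrightarrow> v = w"
  using bij_f[of t] by (auto simp: bij_betw_def inj_on_def)

lemma cmap_cyc: "x \<in> T.cyc \<Longrightarrow> cmap x \<in> T'.cyc"
  using T.cycD(2,3)[of x] by (simp add: T'.cyc_def T'.edge_def T.edge_def f_edge)

lemma cmap_surj:
  assumes "y \<in> T'.cyc"
  shows "\<exists>x\<in>T.cyc. cmap x = y"
proof -
  have "\<exists>v\<in>V t. f t v = fst (y t)" if "t < n" for t
    using bij_f[OF that] T'.cycD(3)[OF assms that] by (metis bij_betw_imp_surj_on imageE)
  then obtain v where v: "v t \<in> V t" "f t (v t) = fst (y t)" if "t < n" for t by metis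
  define x where "x = (\<lambda>t\<in>{..<n}. (v t, snd (y t)))"
  have x: "fst (x t) = v t" "snd (x t) = snd (y t)" if "t < n" for t using that by (simp_all add: x_def)
  have "T.edge x t" if t: "t < n" for t
    using T'.cycD(2)[OF assms t] f_edge[OF t v(1)[OF t] v(1)[of "Suc t mod n"]]
    by (simp add: T.edge_def T'.edge_def x v t)
  moreover have "x \<in> extensional {..<n}" by (simp add: x_def)
  ultimately have "x \<in> T.cyc" by (simp add: T.cyc_def)
  moreover have "cmap x = y"
    by (rule T'.cycle_eqI) (simp_all add: x v T'.cycD(1)[OF assms])
  ultimately show ?thesis by blast
qed

text \<open>\<open>f\<close> need not preserve zero; subtracting the image of the zero cycle repairs this.\<close>
definition ctrans :: "(nat \<Rightarrow> 'v \<times> 'f) \<Rightarrow> nat \<Rightarrow> 'w \<times> 'f" where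
  "ctrans x = T'.cadd (cmap x) (T'.csmul (-1) (cmap T.czero))"

lemma ctrans_lab: "T'.clab i (ctrans x) = T.clab i x"
  by (simp add: ctrans_def T'.clab_def T.clab_def)

text \<open>As each \<open>f t\<close> is injective, \<open>ctrans x\<close> vanishes at
  \<open>t\<close> exactly where \<open>x\<close> does; this needs no linearity. A preimage of
  \<open>y\<close> is found by adding the image of the zero cycle back and lifting through
  \<open>cmap\<close>.\<close>

lemma ctrans_bij: "bij_betw ctrans (T.supp A) (T'.supp A)"
proof -
  have c0: "cmap T.czero \<in> T'.cyc" by (rule cmap_cyc) simp
  have mem: "ctrans x \<in> T'.supp A \<longleftrightarrow> x \<in> T.supp A" if x: "x \<in> T.cyc" for x
  proof -
    have "ctrans x \<in> T'.cyc" unfolding ctrans_def using cmap_cyc[OF x] c0 by simp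
    moreover have "fst (ctrans x t) = z' t \<longleftrightarrow> fst (x t) = z t" if t: "t < n" for t
    proof -
      interpret W: vspace "V' t" "add' t" "smul' t" "z' t" by (rule T'.vspace_V[OF t])
      have "z t \<in> V t" using vspace.zero_mem[OF T.vspace_V[OF t]] .
      moreover have "fst (x t) \<in> V t" using T.cycD(3)[OF x t] .
      moreover have "f t v \<in> V' t" if "v \<in> V t" for v using bij_f[OF t] that by (auto simp: bij_betw_def)
      ultimately show ?thesis using t by (simp add: ctrans_def W.diff_eq_zero f_eq_iff)
    qed
    ultimately show ?thesis using x by (simp add: T.supp_def T'.supp_def)
  qed
  have inj: "inj_on ctrans T.cyc"
  proof (rule inj_onI)
    fix x y assume xy: "x \<in> T.cyc" "y \<in> T.cyc" "ctrans x = ctrans y"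
    have "T'.cadd (ctrans x) (cmap T.czero) = T'.cadd (ctrans y) (cmap T.czero)" using xy by simp
    hence e: "cmap x = cmap y" using xy c0 cmap_cyc by (simp add: ctrans_def)
    show "x = y"
    proof (rule T.cycle_eqI)
      fix t assume t: "t < n"
      have "fst (cmap x t) = fst (cmap y t)" "snd (cmap x t) = snd (cmap y t)" using e by simp_all
      thus "fst (x t) = fst (y t)" "snd (x t) = snd (y t)"
        using t xy by (simp_all add: f_eq_iff T.cycD)
    qed (use xy T.cycD in simp_all)
  qed
  have "ctrans ` T.supp A = T'.supp A"
  proof (intro equalityI subsetI)
    fix y assume "y \<in> ctrans ` T.supp A"
    then obtain x where "x \<in> T.supp A" "y = ctrans x" by blast
    thus "y \<in> T'.supp A" using mem[of x] by (simp add: T.supp_def)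
  next
    fix y assume y: "y \<in> T'.supp A"
    hence yc: "y \<in> T'.cyc" by (simp add: T'.supp_def)
    hence "T'.cadd y (cmap T.czero) \<in> T'.cyc" using c0 by simp
    then obtain x where x: "x \<in> T.cyc" "cmap x = T'.cadd y (cmap T.czero)" using cmap_surj by blast
    have "ctrans x = y" using x yc c0 by (simp add: ctrans_def)
    thus "y \<in> ctrans ` T.supp A" using mem[OF x(1)] y by blast
  qed
  moreover have "inj_on ctrans (T.supp A)" using inj by (rule inj_on_subset) (auto simp: T.supp_def)
  ultimately show ?thesis by (simp add: bij_betw_def)
qed

lemma ex_cycle_iso:
  "\<exists>G. P.partial_iso G \<and> T.cyc \<subseteq> Domain G \<and> T'.cyc \<subseteq> Range G \<and>
     (\<forall>j<n * n. \<forall>x y. (x, y) \<in> G \<longrightarrow> (x \<in> T.supp (narc n j) \<longleftrightarrow> y \<in> T'.supp (narc n j)))"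
proof -
  have "\<exists>G. P.partial_iso G \<and> (\<forall>j<n * n. T.supp (narc n j) \<subseteq> Domain G \<and> T'.supp (narc n j) \<subseteq> Range G \<and>
      (\<forall>x y. (x, y) \<in> G \<longrightarrow> (x \<in> T.supp (narc n j) \<longleftrightarrow> y \<in> T'.supp (narc n j))))"
  \<comment> \<open>The \<open>n * n\<close> indices run through the lengths 0 to
    \<open>n - 1\<close> with all \<open>n\<close> starting points each; the same map
    \<open>ctrans\<close> does the counting for every arc.\<close>
  proof (rule P.extend_family[where h = "\<lambda>_. ctrans" and Q = T.narc_cut and Q' = T'.narc_cut])
    fix j x assume "j < n * n" "x \<in> T.supp (narc n j)" "x \<in> T.narc_cut j"
    from T.narc_split[OF this]
    show "x = T.czero \<or> (\<exists>k<j. \<exists>l<j. \<exists>p\<in>T.supp (narc n k). \<exists>q\<in>T.supp (narc n l). x = T.cadd p q \<and>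
        T'.supp (narc n k) \<subseteq> T'.supp (narc n j) \<and> T'.supp (narc n l) \<subseteq> T'.supp (narc n j))"
      using T'.supp_mono by meson
  next
    fix j x assume "j < n * n" "x \<in> T'.supp (narc n j)" "x \<in> T'.narc_cut j"
    from T'.narc_split[OF this]
    show "x = T'.czero \<or> (\<exists>k<j. \<exists>l<j. \<exists>p\<in>T'.supp (narc n k). \<exists>q\<in>T'.supp (narc n l). x = T'.cadd p q \<and>
        T.supp (narc n k) \<subseteq> T.supp (narc n j) \<and> T.supp (narc n l) \<subseteq> T.supp (narc n j))"
      using T.supp_mono by meson
  qed (simp_all add: T.supp_subsp T'.supp_subsp ctrans_bij ctrans_lab T.narc_cut_subsp T'.narc_cut_subsp
      T.supp_subset_narc_cut T'.supp_subset_narc_cut)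
  then obtain G where G: "P.partial_iso G"
    and cover: "\<And>j. j < n * n \<Longrightarrow> T.supp (narc n j) \<subseteq> Domain G"
      "\<And>j. j < n * n \<Longrightarrow> T'.supp (narc n j) \<subseteq> Range G"
    and compat: "\<And>j x y. j < n * n \<Longrightarrow> (x, y) \<in> G \<Longrightarrow> x \<in> T.supp (narc n j) \<longleftrightarrow> y \<in> T'.supp (narc n j)"
    by auto
  have full: "T.supp UNIV = T.cyc" "T'.supp UNIV = T'.cyc" by (auto simp: T.supp_def T'.supp_def)
  \<comment> \<open>Cycles supported on proper arcs need not span all cycles, so a last extension
    reaches the whole space. Compatibility is automatic, as every pair of \<open>G\<close> consists
    of cycles.\<close>
  have "\<exists>G'. P.extends_by G T.cyc T'.cyc G'"
    using P.extend[OF G T.C.subsp_S T'.C.subsp_S ctrans_bij[of UNIV, unfolded full] ctrans_lab]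
      P.partial_isoD(1,2)[OF G] by blast
  then obtain G' where "P.extends_by G T.cyc T'.cyc G'" ..
  note G' = P.extends_byD[OF this]
  have "x \<in> T.supp (narc n j) \<longleftrightarrow> y \<in> T'.supp (narc n j)" if j: "j < n * n" and xy: "(x, y) \<in> G'" for j x y
  proof
    assume x: "x \<in> T.supp (narc n j)"
    then obtain y' where y': "(x, y') \<in> G" using cover(1)[OF j] by blast
    hence "y = y'" using P.partial_iso_inj[OF G'(1) xy, of x y'] G'(2) by auto
    thus "y \<in> T'.supp (narc n j)" using compat[OF j y'] x by simp
  next
    assume y: "y \<in> T'.supp (narc n j)"
    then obtain x' where x': "(x', y) \<in> G" using cover(2)[OF j] by blast
    hence "x = x'" using P.partial_iso_inj[OF G'(1) xy, of x' y] G'(2) by auto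
    thus "x \<in> T.supp (narc n j)" using compat[OF j x'] y by simp
  qed
  thus ?thesis using G'(1,3,4) by (intro exI[of _ G'] conjI allI impI)
qed

end

theorem mainTheorem6:
  fixes n :: nat
    and V :: "nat \<Rightarrow> 'v set" and E :: "nat \<Rightarrow> ('v \<times> 'f::{field,finite} \<times> 'v) set"
    and add :: "nat \<Rightarrow> 'v \<Rightarrow> 'v \<Rightarrow> 'v" and smul :: "nat \<Rightarrow> 'f \<Rightarrow> 'v \<Rightarrow> 'v" and z :: "nat \<Rightarrow> 'v"
    and V' :: "nat \<Rightarrow> 'w set" and E' :: "nat \<Rightarrow> ('w \<times> 'f \<times> 'w) set"
    and add' :: "nat \<Rightarrow> 'w \<Rightarrow> 'w \<Rightarrow> 'w" and smul' :: "nat \<Rightarrow> 'f \<Rightarrow> 'w \<Rightarrow> 'w" and z' :: "nat \<Rightarrow> 'w"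
    and f :: "nat \<Rightarrow> 'v \<Rightarrow> 'w"
  assumes "linear_trellis n V E add smul z"
    and "linear_trellis n V' E' add' smul' z'"
    and "reduced n V E"
    and "reduced n V' E'"
    and "trellis_iso n V E V' E' f"
  shows "\<exists>g. linear_trellis_iso n V E add smul V' E' add' smul' g"
proof -
  interpret iso_trellis_pair n V E add smul z V' E' add' smul' z' f
    by unfold_locales (fact assms)+
  obtain G where G: "P.partial_iso G" and dom: "T.cyc \<subseteq> Domain G" and ran: "T'.cyc \<subseteq> Range G"
    and compat: "\<And>j x y. j < n * n \<Longrightarrow> (x, y) \<in> G \<Longrightarrow> x \<in> T.supp (narc n j) \<longleftrightarrow> y \<in> T'.supp (narc n j)"
    using ex_cycle_iso by auto
  note D = P.partial_isoD[OF G]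
  have vertex_zero: "fst (x i) = z i \<longleftrightarrow> fst (y i) = z' i" if i: "i < n" and xy: "(x, y) \<in> G" for i x y
  proof -
    \<comment> \<open>The index of the arc of length \<open>n - 1\<close> starting just after
      \<open>i\<close>, which is the complement of \<open>i\<close>.\<close>
    define j where "j = n * (n - 1) + Suc i mod n"
    have "j < n * (n - 1) + n" unfolding j_def using i by simp
    also have "\<dots> = n * n" using i by (cases n) simp_all
    finally have j: "j < n * n" .
    have "narc n j = {..<n} - {i}" using arc_complement[OF i] i by (simp add: narc_def j_def)
    thus ?thesis using compat[OF j xy] D(1,2)[OF xy] i by (auto simp: T.supp_def T'.supp_def)
  qed
  have vertex_eq: "fst (x i) = fst (u i) \<longleftrightarrow> fst (y i) = fst (w i)"
    if i: "i < n" and xy: "(x, y) \<in> G" and uw: "(u, w) \<in> G" for i x y u w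
  proof -
    have "(T.cadd x (T.csmul (-1) u), T'.cadd y (T'.csmul (-1) w)) \<in> G" by (intro D xy uw)
    from vertex_zero[OF i this] show ?thesis
      using i vspace.diff_eq_zero[OF T.vspace_V[OF i]] vspace.diff_eq_zero[OF T'.vspace_V[OF i]]
        T.cycD(3)[OF D(1)[OF xy] i] T.cycD(3)[OF D(1)[OF uw] i]
        T'.cycD(3)[OF D(2)[OF xy] i] T'.cycD(3)[OF D(2)[OF uw] i] by simp
  qed
  \<comment> \<open>Projects \<open>G\<close> to time \<open>i\<close>: \<open>v\<close> is lifted
    to any cycle through it and the partner is evaluated at \<open>i\<close>. By
    \<open>vertex_eq\<close> the lift does not matter.\<close>
  define g where "g i v = (SOME w. \<exists>x y. (x, y) \<in> G \<and> fst (x i) = v \<and> fst (y i) = w)" for i v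
  have g: "g i (fst (x i)) = fst (y i)" if i: "i < n" and xy: "(x, y) \<in> G" for i x y
    unfolding g_def
  proof (rule some_equality)
    fix w assume "\<exists>u v. (u, v) \<in> G \<and> fst (u i) = fst (x i) \<and> fst (v i) = w"
    then obtain u v where "(u, v) \<in> G" "fst (u i) = fst (x i)" "fst (v i) = w" by blast
    thus "w = fst (y i)" using vertex_eq[OF i xy, of u v] by simp
  qed (use xy in blast)
  have lift: "\<exists>x y. (x, y) \<in> G \<and> fst (x i) = v" if "i < n" "v \<in> V i" for i v
    using T.vertex_on_cycle[OF assms(3) that] dom by blast
  have lift': "\<exists>x y. (x, y) \<in> G \<and> fst (y i) = w" if "i < n" "w \<in> V' i" for i w
    using T'.vertex_on_cycle[OF assms(4) that] ran by blast
  have bij: "bij_betw (g i) (V i) (V' i)" if i: "i < n" for i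
    unfolding bij_betw_def
  proof
    show "inj_on (g i) (V i)"
    proof (rule inj_onI)
      fix v w assume "v \<in> V i" "w \<in> V i" and e: "g i v = g i w"
      then obtain x y x' y' where *: "(x, y) \<in> G" "fst (x i) = v" "(x', y') \<in> G" "fst (x' i) = w"
        using lift[OF i] by blast
      thus "v = w" using vertex_eq[OF i *(1,3)] g[OF i *(1)] g[OF i *(3)] e by simp
    qed
    show "g i ` V i = V' i"
    proof (intro equalityI subsetI)
      fix w assume "w \<in> g i ` V i"
      then obtain v x y where "w = g i v" and *: "(x, y) \<in> G" "fst (x i) = v" using lift[OF i] by blast
      thus "w \<in> V' i" using g[OF i *(1)] T'.cycD(3)[OF D(2)[OF *(1)] i] by simp
    next
      fix w assume "w \<in> V' i"
      then obtain x y where *: "(x, y) \<in> G" "fst (y i) = w" using lift'[OF i] by blast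
      have "w = g i (fst (x i))" using g[OF i *(1)] * by simp
      thus "w \<in> g i ` V i" using T.cycD(3)[OF D(1)[OF *(1)] i] by blast
    qed
  qed
  have "trellis_iso n V E V' E' g"
    unfolding trellis_iso_def
  proof (intro conjI allI impI ballI)
    fix i v w a assume i: "i < n" and v: "v \<in> V i" and w: "w \<in> V (Suc i mod n)"
    have si: "Suc i mod n < n" by simp
    show "(v, a, w) \<in> E i \<longleftrightarrow> (g i v, a, g (Suc i mod n) w) \<in> E' i"
    proof
      assume "(v, a, w) \<in> E i"
      then obtain x where x: "x \<in> T.cyc" "v = fst (x i)" "a = snd (x i)" "w = fst (x (Suc i mod n))"
        using T.edge_on_cycle[OF assms(3) i] by blast
      then obtain y where xy: "(x, y) \<in> G" using dom by blast
      have "snd (x i) = snd (y i)" using D(7)[OF xy, of i] i by (simp add: T.clab_def T'.clab_def)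
      thus "(g i v, a, g (Suc i mod n) w) \<in> E' i"
        using T'.cycD(2)[OF D(2)[OF xy] i] x g[OF i xy] g[OF si xy] by (simp add: T'.edge_def)
    next
      assume "(g i v, a, g (Suc i mod n) w) \<in> E' i"
      then obtain y where y: "y \<in> T'.cyc" "g i v = fst (y i)" "a = snd (y i)"
        "g (Suc i mod n) w = fst (y (Suc i mod n))"
        using T'.edge_on_cycle[OF assms(4) i] by blast
      then obtain x where xy: "(x, y) \<in> G" using ran by blast
      have x: "x \<in> T.cyc" by (rule D(1)[OF xy])
      have "snd (x i) = snd (y i)" using D(7)[OF xy, of i] i by (simp add: T.clab_def T'.clab_def)
      \<comment> \<open>The partner \<open>x\<close> of \<open>y\<close> need only be compared with
        \<open>v\<close> and \<open>w\<close> through \<open>g\<close>, whose injectivity identifies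
        the end points.\<close>
      moreover have "fst (x i) = v"
        using bij[OF i] g[OF i xy] y(2) v T.cycD(3)[OF x i] by (auto simp: bij_betw_def inj_on_def)
      moreover have "fst (x (Suc i mod n)) = w"
        using bij[OF si] g[OF si xy] y(4) w T.cycD(3)[OF x si] by (auto simp: bij_betw_def inj_on_def)
      ultimately show "(v, a, w) \<in> E i" using T.cycD(2)[OF x i] y(3) by (simp add: T.edge_def)
    qed
  qed (rule bij)
  \<comment> \<open>Linearity descends from \<open>G\<close>, because sums and multiples of cycles
    are formed vertex by vertex.\<close>
  moreover have "g i (add i v w) = add' i (g i v) (g i w)" if i: "i < n" and "v \<in> V i" "w \<in> V i" for i v w
  proof -
    obtain x y x' y' where *: "(x, y) \<in> G" "fst (x i) = v" "(x', y') \<in> G" "fst (x' i) = w"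
      using lift[OF i] \<open>v \<in> V i\<close> \<open>w \<in> V i\<close> by blast
    show ?thesis using g[OF i D(4)[OF *(1,3)]] g[OF i *(1)] g[OF i *(3)] * i by simp
  qed
  moreover have "g i (smul i c v) = smul' i c (g i v)" if i: "i < n" and "v \<in> V i" for i c v
  proof -
    obtain x y where *: "(x, y) \<in> G" "fst (x i) = v" using lift[OF i \<open>v \<in> V i\<close>] by blast
    show ?thesis using g[OF i D(5)[OF *(1), of c]] g[OF i *(1)] * i by simp
  qed
  ultimately have "linear_trellis_iso n V E add smul V' E' add' smul' g"
    unfolding linear_trellis_iso_def by simp
  thus ?thesis by (rule exI[of _ g])
qed

end
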